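(* The period function $\mathcal{E}\mapsto T(\mathcal{E},\omega)$ is a $C^1$ function of $\mathcal{E}\in(0,\infty)\setminus\{\mathcal{E}_\omega\}$ if $\omega\in(0,1)$, and of $\mathcal{E}\in(\mathcal{E}_\omega,\infty)$ if $\omega\in(-\infty,0)$. For any $\omega\in(0,1)$, the mapping $(0,\mathcal{E}_\omega)\ni\mathcal{E}\mapsto T(\mathcal{E},\omega)$ is monotonically increasing. For any $\omega\in(-\infty,1)$, the mapping $(\mathcal{E}_\omega,\infty)\ni\mathcal{E}\mapsto T(\mathcal{E},\omega)$ is monotonically decreasing.
   Context: For $\omega<1$ and $\phi\in(-1,1)$ let $V(\phi)=\frac12(\omega-\phi^2)+\frac12(1-\omega)\log\frac{1-\omega}{1-\phi^2}$. The equation $\phi''=-V'(\phi)=\frac{(\omega-\phi^2)\phi}{1-\phi^2}$ conserves $E(\phi,\phi')=\frac12(\phi')^2+V(\phi)$. Set $\mathcal{E}_\omega=V(0)=\frac12\omega+\frac12(1-\omega)\log(1-\omega)$. The period function is $T(\mathcal{E},\omega)=\oint\frac{d\phi}{\sqrt{2(\mathcal{E}-V(\phi))}}$, the line integral along the closed periodic orbit on the level $E(\phi,\phi')=\mathcal{E}$, i.e. the fundamental period of that orbit. Explicitly: for $\omega\in(0,1)$ and $\mathcal{E}\in(0,\mathcal{E}_\omega)$, the orbit is the one in $\phi>0$ (or its mirror image under $\phi\mapsto-\phi$) and $T(\mathcal{E},\omega)=2\int_m^M\frac{d\phi}{\sqrt{2(\mathcal{E}-V(\phi))}}$, where $0<m<\sqrt{\omega}<M<1$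 are the two positive roots of $V(\phi)=\mathcal{E}$; for $\omega<1$ and $\mathcal{E}>\mathcal{E}_\omega$, the orbit surrounds the origin and $T(\mathcal{E},\omega)=4\int_0^M\frac{d\phi}{\sqrt{2(\mathcal{E}-V(\phi))}}$, where $M\in(0,1)$ is the unique positive root of $V(\phi)=\mathcal{E}$. *)

theory Defs
  imports "HOL-Analysis.Analysis"
begin

definition potential :: "real \<Rightarrow> real \<Rightarrow> real" where
  "potential \<omega> \<phi> =
     (\<omega> - \<phi>\<^sup>2) / 2 + (1 - \<omega>) / 2 * ln ((1 - \<omega>) / (1 - \<phi>\<^sup>2))"

definition crit_energy :: "real \<Rightarrow> real" where
  "crit_energy \<omega> = potential \<omega> 0"

text \<open>
  For \<open>0 < \<omega> < 1\<close> and \<open>0 < \<E> < crit_energy \<omega>\<close> the turning points \<open>m < M\<close> of the orbit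
  in \<open>\<phi> > 0\<close> are separated by the minimum \<open>sqrt \<omega>\<close> of the potential.
  For \<open>\<omega> < 1\<close> and \<open>\<E> > crit_energy \<omega>\<close> the orbit surrounds the origin and has turning
  points \<open>M\<close> and \<open>-M\<close>. In each of these ranges the root is unique.
\<close>

definition inner_min :: "real \<Rightarrow> real \<Rightarrow> real" where
  "inner_min \<omega> \<E> = (THE m. 0 < m \<and> m < sqrt \<omega> \<and> potential \<omega> m = \<E>)"

definition inner_max :: "real \<Rightarrow> real \<Rightarrow> real" where
  "inner_max \<omega> \<E> = (THE M. sqrt \<omega> < M \<and> M < 1 \<and> potential \<omega> M = \<E>)"

definition outer_max :: "real \<Rightarrow> real \<Rightarrow> real" where
  "outer_max \<omega> \<E> = (THE M. 0 < M \<and> M < 1 \<and> potential \<omega> M = \<E>)"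

text \<open>
  The period is the integral of \<open>1 / \<phi>'\<close> along the closed orbit on the level \<open>\<E>\<close>,
  with \<open>\<phi>' = sqrt (2 * (\<E> - potential \<omega> \<phi>))\<close> on its upper half, reduced by symmetry to
  one half (inner orbit) or one quarter (outer orbit) of the loop. The integrand has
  inverse square root singularities at the turning points, where its formal value
  \<open>1 / 0 = 0\<close> is irrelevant. The definition is meaningful only in the two parameter
  ranges above; its value elsewhere is a dummy.
\<close>

definition period :: "real \<Rightarrow> real \<Rightarrow> real" where
  "period \<omega> \<E> =
     (if 0 < \<omega> \<and> \<omega> < 1 \<and> 0 < \<E> \<and> \<E> < crit_energy \<omega> then
        2 * integral {inner_min \<omega> \<E>..inner_max \<omega> \<E>}
              (\<lambda>\<phi>. 1 / sqrt (2 * (\<E> - potential \<omega> \<phi>)))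
      else if \<omega> < 1 \<and> crit_energy \<omega> < \<E> then
        4 * integral {0..outer_max \<omega> \<E>}
              (\<lambda>\<phi>. 1 / sqrt (2 * (\<E> - potential \<omega> \<phi>)))
      else 0)"

end

(*
  Both kinds of orbit are parametrised so that the period becomes a proper integral of a smooth
  function over a fixed interval of angles.

  Inner orbits: with 1 + x = (1 - phi^2) / (1 - omega) the potential is (1 - omega) / 2 * (x - ln (1 + x)).
  A new coordinate h with h^2 / 2 = x - ln (1 + x) makes it quadratic, and h = r sin theta turns the
  period into a constant times the integral of d/dh phi(h) at h = r sin theta over [-pi/2, pi/2].
  Its r-derivative is the integral of sin theta * phi''(r sin theta), which has a sign
  because the second derivative of phi is monotone.

  Outer orbits: with B = M^2 / (1 - M^2) and phi = M sin theta the period is four times the integral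
  of H(B, theta)^(-1/2) over [0, pi/2], where
    H = (1 - omega) * (integral over t in [0, 1] of (1 + B) / (1 + B t cos^2 theta)) - 1
  is increasing in B.

  In both cases the energy is a smooth strictly increasing function of the parameter.
*)
theory Submission
  imports Defs
begin

section \<open>Substitution with singular end points, parameter integrals, and smoothness through a
  reparametrisation\<close>

section \<open>Calculus\<close>

text \<open>Made for integrands \<open>f\<close> that blow up at the turning points
  \<open>g a\<close> and \<open>g b\<close>. All regularity sits in the pullback \<open>k\<close>:
  its continuity on the closed interval yields absolute integrability, and the change of variables
  takes place on the open interval, whose missing end points do not affect the integral.\<close>

lemma integral_substitution_Ioo:
  fixes f g g' k :: "real \<Rightarrow> real"
  assumes "a < b"
    and contg: "continuous_on {a..b} g"
    and der: "\<And>x. x \<in> {a<..<b} \<Longrightarrow> (g has_real_derivative g' x) (at x)"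
    and pos: "\<And>x. x \<in> {a<..<b} \<Longrightarrow> 0 < g' x"
    and contk: "continuous_on {a..b} k"
    and eq: "\<And>x. x \<in> {a<..<b} \<Longrightarrow> g' x * f (g x) = k x"
  shows "integral {g a..g b} f = integral {a..b} k"
proof -
  have mono: "g x < g y" if "a \<le> x" "x < y" "y \<le> b" for x y
  proof (rule DERIV_pos_imp_increasing_open [OF \<open>x < y\<close>])
    show "\<exists>l. (g has_real_derivative l) (at z) \<and> 0 < l" if "x < z" "z < y" for z
      using that \<open>a \<le> x\<close> \<open>y \<le> b\<close> der [of z] pos [of z] by auto
    show "continuous_on {x..y} g"
      using contg by (rule continuous_on_subset) (use that in auto)
  qed
  have inj: "inj_on g {a<..<b}"
    unfolding inj_on_def by (auto, metis less_imp_le linorder_neqE mono order_less_irrefl)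
  have img: "g ` {a<..<b} = {g a<..<g b}"
  proof
    show "g ` {a<..<b} \<subseteq> {g a<..<g b}"
      using mono by auto
    show "{g a<..<g b} \<subseteq> g ` {a<..<b}"
    proof
      fix y assume y: "y \<in> {g a<..<g b}"
      then obtain x where "a \<le> x" "x \<le> b" "g x = y"
        using IVT' [of g a y b] contg \<open>a < b\<close> by auto
      with y show "y \<in> g ` {a<..<b}"
        by (cases "x = a"; cases "x = b") auto
    qed
  qed
  have cong: "\<bar>g' x\<bar> * f (g x) = k x" if "x \<in> {a<..<b}" for x
    using eq [OF that] pos [OF that] by simp
  have "k absolutely_integrable_on {a<..<b}"
    using absolutely_integrable_continuous_real [OF contk] absolutely_integrable_on_open_interval [of a b k] by (simp add: box_real)
  moreover have "(\<lambda>x. \<bar>g' x\<bar> * f (g x)) absolutely_integrable_on {a<..<b}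
      \<longleftrightarrow> k absolutely_integrable_on {a<..<b}"
    by (intro set_integrable_cong refl cong)
  ultimately have ai: "(\<lambda>x. \<bar>g' x\<bar> * f (g x)) absolutely_integrable_on {a<..<b}"
    by simp
  have "integral {a<..<b} (\<lambda>x. \<bar>g' x\<bar> * f (g x)) = integral {a<..<b} k"
    by (rule integral_cong) (rule cong)
  then have "integral (g ` {a<..<b}) f = integral {a<..<b} k"
    using has_absolute_integral_change_of_variables_1' [of "{a<..<b}" g g' f "integral {a<..<b} k"]
      ai inj der by (auto intro: has_field_derivative_at_within)
  then show ?thesis
    by (simp add: img integral_open_interval_real)
qed

lemma leibniz_C1:
  fixes f f' :: "real \<Rightarrow> real \<Rightarrow> real"
  assumes U: "open U" "convex U"
    and der: "\<And>x t. x \<in> U \<Longrightarrow> t \<in> {a..b} \<Longrightarrow> ((\<lambda>x. f x t) has_real_derivative f' x t) (at x)"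
    and int: "\<And>x. x \<in> U \<Longrightarrow> continuous_on {a..b} (f x)"
    and cont: "continuous_on (U \<times> {a..b}) (\<lambda>(x, t). f' x t)"
  shows "x \<in> U \<Longrightarrow> ((\<lambda>x. integral {a..b} (f x)) has_real_derivative integral {a..b} (f' x)) (at x)"
    and "continuous_on U (\<lambda>x. integral {a..b} (f' x))"
proof -
  show "((\<lambda>x. integral {a..b} (f x)) has_real_derivative integral {a..b} (f' x)) (at x)" if "x \<in> U"
  proof -
    have "((\<lambda>x. integral (cbox a b) (f x)) has_real_derivative integral (cbox a b) (f' x))
        (at x within U)"
      by (rule leibniz_rule_field_derivative)
        (use assms that in \<open>auto intro: has_field_derivative_at_within integrable_continuous_real\<close>)
    then show ?thesis
      using at_within_open [OF that U(1)] by simp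
  qed
  show "continuous_on U (\<lambda>x. integral {a..b} (f' x))"
    using integral_continuous_on_param [of U a b f'] cont by simp
qed

text \<open>Turns smoothness in an orbit parameter into smoothness in the energy: \<open>S\<close>
  is the period as a function of the parameter and \<open>e\<close> the energy. The inverse function
  theorem makes the inverse of \<open>e\<close> differentiable with continuous derivative, and the
  chain rule does the rest.\<close>

lemma C1_differentiable_on_reparam:
  fixes f e e' S S' :: "real \<Rightarrow> real"
  assumes X: "open X" and Y: "open (e ` X)" and inj: "inj_on e X"
    and e: "\<And>x. x \<in> X \<Longrightarrow> (e has_real_derivative e' x) (at x)" "\<And>x. x \<in> X \<Longrightarrow> e' x \<noteq> 0"
      "continuous_on X e'"
    and S: "\<And>x. x \<in> X \<Longrightarrow> (S has_real_derivative S' x) (at x)" "continuous_on X S'"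
    and f: "\<And>x. x \<in> X \<Longrightarrow> f (e x) = S x"
  shows "f C1_differentiable_on (e ` X)"
proof -
  define g where "g = the_inv_into X e"
  have ge: "g (e x) = x" if "x \<in> X" for x
    using the_inv_into_f_f [OF inj that] by (simp add: g_def)
  have conte: "continuous_on X e"
    using e(1) by (meson DERIV_continuous continuous_at_imp_continuous_on)
  have derg: "(g has_real_derivative inverse (e' x)) (at (e x))" if "x \<in> X" for x
    unfolding has_field_derivative_def
    by (rule has_derivative_inverse_strong [OF X that conte ge])
      (use e(1) [OF that] e(2) [OF that] in \<open>auto simp: has_field_derivative_def\<close>)
  have contg: "continuous_on (e ` X) g"
    by (intro continuous_at_imp_continuous_on ballI) (auto intro: DERIV_isCont derg)
  have "(f has_vector_derivative S' (g y) * inverse (e' (g y))) (at y)" if y: "y \<in> e ` X" for y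
  proof -
    obtain x where x: "x \<in> X" "y = e x" using y by auto
    have "((\<lambda>y. S (g y)) has_real_derivative S' (g y) * inverse (e' (g y))) (at y)"
      using DERIV_chain2 [of S "S' (g y)" g y] S(1) derg [OF x(1)] x ge [OF x(1)] by simp
    then have "(f has_real_derivative S' (g y) * inverse (e' (g y))) (at y)"
      by (rule has_field_derivative_transform_within_open [OF _ Y y]) (auto simp: ge f)
    then show ?thesis
      by (simp add: has_real_derivative_iff_has_vector_derivative)
  qed
  moreover have "continuous_on (e ` X) (\<lambda>y. S' (g y) * inverse (e' (g y)))"
    using e(2)
    by (intro continuous_intros continuous_on_compose2 [OF S(2) contg]
        continuous_on_compose2 [OF e(3) contg]) (auto simp: ge)
  ultimately show ?thesis
    unfolding C1_differentiable_on_def by (intro exI [of _ "\<lambda>y. S' (g y) * inverse (e' (g y))"]) auto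
qed

lemma DERIV_pos_imp_strict_mono_on:
  fixes f f' :: "real \<Rightarrow> real"
  assumes "convex X" and "\<And>x. x \<in> X \<Longrightarrow> (f has_real_derivative f' x) (at x)"
    and "\<And>x. x \<in> X \<Longrightarrow> 0 < f' x"
  shows "strict_mono_on X f"
proof (rule strict_mono_onI)
  fix x y assume xy: "x \<in> X" "y \<in> X" "x < y"
  then have "z \<in> X" if "x \<le> z" "z \<le> y" for z
    using \<open>convex X\<close> that by (meson is_interval_1 is_interval_convex_1)
  then show "f x < f y"
    by (intro DERIV_pos_imp_increasing [OF \<open>x < y\<close>]) (use assms in blast)
qed

lemma integral_pos:
  fixes f :: "real \<Rightarrow> real"
  assumes "a < b" "continuous_on {a..b} f" "\<And>x. x \<in> {a..b} \<Longrightarrow> 0 \<le> f x"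
    "c \<in> {a..b}" "f c \<noteq> 0"
  shows "0 < integral {a..b} f"
proof -
  have "integral {a..b} f \<noteq> 0"
    using integral_eq_0_iff [of a b f] assms by auto
  moreover have "0 \<le> integral {a..b} f"
    using assms by (intro integral_nonneg integrable_continuous_real) auto
  ultimately show ?thesis by simp
qed

lemma C1_differentiable_on_open_Un:
  assumes "f C1_differentiable_on S" "f C1_differentiable_on T" "open S" "open T"
  shows "f C1_differentiable_on (S \<union> T)"
  using assms unfolding C1_differentiable_on_eq by (auto intro: continuous_on_open_Un)

section \<open>Integral forms of logarithmic quotients, smooth across the origin\<close>

section \<open>The kernel integrals\<close>

text \<open>Smooth extensions of quotients with a removable singularity: for x \<noteq> 0,
  \<open>kernel_integral 0 1 x\<close> is \<open>ln (1 + x) / x\<close> and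
  \<open>kernel_integral 1 1 x\<close> is \<open>(x - ln (1 + x)) / x\<^sup>2\<close>. Two indices
  are kept because differentiation in \<open>x\<close> raises both by one.\<close>

definition kernel_integral :: "nat \<Rightarrow> nat \<Rightarrow> real \<Rightarrow> real" where
  "kernel_integral n k x = integral {0..1} (\<lambda>t. t ^ n / (1 + x * t) ^ k)"

lemma kernel_pos:
  fixes x t :: real
  assumes "-1 < x" "t \<in> {0..1}"
  shows "0 < 1 + x * t"
proof (cases "x \<ge> 0")
  case False
  then have "\<bar>x * t\<bar> \<le> \<bar>x\<bar> * 1"
    using assms unfolding abs_mult by (intro mult_mono) auto
  with False assms show ?thesis by auto
qed (use assms in \<open>auto intro: add_pos_nonneg\<close>)

lemma continuous_on_kernel:
  fixes x :: real
  assumes "-1 < x"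
  shows "continuous_on {0..1} (\<lambda>t. t ^ n / (1 + x * t) ^ k)"
proof -
  have "1 + x * t \<noteq> 0" if "t \<in> {0..1}" for t
    using kernel_pos [OF assms that] by simp
  then show ?thesis
    by (intro continuous_intros) auto
qed

lemma DERIV_divide_power:
  fixes a u :: real
  assumes "u \<noteq> 0"
  shows "((\<lambda>u. a / u ^ k) has_real_derivative - (real k * (a / u ^ Suc k))) (at u)"
proof (induction k)
  case (Suc k)
  have "((\<lambda>u. a / u ^ k * (1 / u)) has_real_derivative
      a / u ^ k * (- (1 / u\<^sup>2)) + - (real k * (a / u ^ Suc k)) * (1 / u)) (at u)"
    by (rule DERIV_mult' [OF Suc])
      (use assms in \<open>auto intro!: derivative_eq_intros simp: power2_eq_square\<close>)
  moreover have "a / u ^ k * (- (1 / u\<^sup>2)) + - (real k * (a / u ^ Suc k)) * (1 / u)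
      = - (real (Suc k) * (a / u ^ Suc (Suc k)))"
    using assms by (simp add: field_simps power2_eq_square)
  ultimately show ?case
    by (simp only: times_divide_times_eq mult_1_right power_Suc2 [symmetric])
qed auto

lemma DERIV_kernel_integral:
  assumes "-1 < x"
  shows "(kernel_integral n k has_real_derivative
      - (real k * kernel_integral (Suc n) (Suc k) x)) (at x)"
proof -
  let ?f' = "\<lambda>x t::real. - real k * (t ^ Suc n / (1 + x * t) ^ Suc k)"
  have "((\<lambda>x. t ^ n / (1 + x * t) ^ k) has_real_derivative ?f' x t) (at x)"
    if "x \<in> {-1<..}" "t \<in> {0..1}" for x t
  proof -
    have "1 + x * t \<noteq> 0" using kernel_pos [of x t] that by auto
    from DERIV_divide_power [OF this, of "t ^ n" k]
    have "((\<lambda>x. t ^ n / (1 + x * t) ^ k) has_real_derivative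
        - (real k * (t ^ n / (1 + x * t) ^ Suc k)) * t) (at x)"
      by (rule DERIV_chain2) (auto intro!: derivative_eq_intros)
    then show ?thesis
      by (simp add: mult_ac)
  qed
  moreover have "continuous_on ({-1<..} \<times> {0..1}) (\<lambda>(x, t). ?f' x t)"
    unfolding split_beta
    by (intro continuous_intros ballI power_not_zero) (auto dest: kernel_pos)
  ultimately have "((\<lambda>x. integral {0..1} (\<lambda>t. t ^ n / (1 + x * t) ^ k)) has_real_derivative
      integral {0..1} (?f' x)) (at x)"
    using leibniz_C1(1) [of "{-1<..}" 0 1 "\<lambda>x t. t ^ n / (1 + x * t) ^ k" ?f' x]
      continuous_on_kernel assms by auto
  then show ?thesis
    by (simp only: kernel_integral_def [abs_def] integral_mult_right integral_neg mult_minus_left)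
qed

lemma has_integral_kernel:
  "-1 < x \<Longrightarrow> ((\<lambda>t. t ^ n / (1 + x * t) ^ k) has_integral kernel_integral n k x) {0..1}"
  for x :: real
  unfolding kernel_integral_def
  by (intro integrable_integral integrable_continuous_real continuous_on_kernel)

lemma has_integral_FTC_01:
  fixes F f :: "real \<Rightarrow> real"
  assumes "\<And>t. t \<in> {0..1} \<Longrightarrow> (F has_real_derivative f t) (at t)"
  shows "(f has_integral F 1 - F 0) {0..1}"
  using assms
  by (intro fundamental_theorem_of_calculus)
    (auto simp: has_real_derivative_iff_has_vector_derivative [symmetric]
      intro: has_field_derivative_at_within)

lemma kernel_integral_pos:
  assumes "-1 < x"
  shows "0 < kernel_integral n k x"
  unfolding kernel_integral_def
proof (rule integral_pos [where c = 1])
  fix t :: real assume "t \<in> {0..1}"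
  then show "0 \<le> t ^ n / (1 + x * t) ^ k"
    using kernel_pos [OF assms, of t] by simp
qed (use assms in \<open>auto intro!: continuous_on_kernel\<close>)

text \<open>A primitive of the integrand times \<open>x\<close> is \<open>ln (1 + x * t)\<close>.
  The factor \<open>x\<close> stays on the left so that \<open>x = 0\<close> is covered.\<close>

lemma kernel_integral_ln:
  assumes "-1 < x"
  shows "x * kernel_integral 0 1 x = ln (1 + x)"
proof -
  have "((\<lambda>t. ln (1 + x * t)) has_real_derivative x * (t ^ 0 / (1 + x * t) ^ 1)) (at t)"
    if "t \<in> {0..1}" for t
    using kernel_pos [OF assms that] by (auto intro!: derivative_eq_intros)
  from has_integral_unique [OF has_integral_mult_right [OF has_integral_kernel [OF assms]]
      has_integral_FTC_01 [OF this]]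
  show ?thesis by simp
qed

lemma kernel_integral_diff_ln:
  assumes "-1 < x"
  shows "x\<^sup>2 * kernel_integral 1 1 x = x - ln (1 + x)"
proof -
  have "((\<lambda>t. x * t - ln (1 + x * t)) has_real_derivative x\<^sup>2 * (t ^ 1 / (1 + x * t) ^ 1)) (at t)"
    if "t \<in> {0..1}" for t
    using kernel_pos [OF assms that]
    by (auto intro!: derivative_eq_intros simp: field_simps power2_eq_square)
  from has_integral_unique [OF has_integral_mult_right [OF has_integral_kernel [OF assms]]
      has_integral_FTC_01 [OF this]]
  show ?thesis by simp
qed

text \<open>The left side is the integral of the total derivative of
  \<open>t\<^sup>2 / (1 + x * t)\<close>. It is the identity that collapses the derivative of
  \<open>lin_coord\<close>.\<close>

lemma kernel_integral_11_22:
  assumes "-1 < x"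
  shows "2 * kernel_integral 1 1 x - x * kernel_integral 2 2 x = 1 / (1 + x)"
proof -
  have "((\<lambda>t. t\<^sup>2 / (1 + x * t)) has_real_derivative
      2 * (t ^ 1 / (1 + x * t) ^ 1) - x * (t ^ 2 / (1 + x * t) ^ 2)) (at t)"
    if "t \<in> {0..1}" for t
  proof -
    have "1 + x * t \<noteq> 0" using kernel_pos [OF assms that] by simp
    then show ?thesis
      by (auto intro!: derivative_eq_intros simp: divide_simps) (simp add: algebra_simps power2_eq_square)
  qed
  from has_integral_FTC_01 [OF this]
  have "((\<lambda>t. 2 * (t ^ 1 / (1 + x * t) ^ 1) - x * (t ^ 2 / (1 + x * t) ^ 2)) has_integral 1 / (1 + x)) {0..1}"
    by simp
  moreover have "((\<lambda>t. 2 * (t ^ 1 / (1 + x * t) ^ 1) - x * (t ^ 2 / (1 + x * t) ^ 2)) has_integral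
      2 * kernel_integral 1 1 x - x * kernel_integral 2 2 x) {0..1}"
    by (intro has_integral_diff has_integral_mult_right has_integral_kernel assms)
  ultimately show ?thesis
    by (rule has_integral_unique [rotated])
qed

text \<open>The function \<open>t\<^sup>2 * (1 - t) / (1 + x * t)\<close> vanishes at both ends of
  the interval, so its derivative integrates to 0. The gain is that a difference of kernels becomes
  a single positive kernel.\<close>

lemma kernel_integral_11_22_21:
  assumes "-1 < x"
  shows "2 * kernel_integral 1 1 x - (1 + x) * kernel_integral 2 2 x = 2 * kernel_integral 2 1 x"
proof -
  have "((\<lambda>t. t\<^sup>2 * (1 - t) / (1 + x * t)) has_real_derivative
      2 * (t ^ 1 / (1 + x * t) ^ 1) - (1 + x) * (t ^ 2 / (1 + x * t) ^ 2)
        - 2 * (t ^ 2 / (1 + x * t) ^ 1)) (at t)"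
    if "t \<in> {0..1}" for t
  proof -
    have "1 + x * t \<noteq> 0" using kernel_pos [OF assms that] by simp
    then show ?thesis
      by (auto intro!: derivative_eq_intros simp: divide_simps) (simp add: algebra_simps power2_eq_square)
  qed
  from has_integral_FTC_01 [OF this]
  have "((\<lambda>t. 2 * (t ^ 1 / (1 + x * t) ^ 1) - (1 + x) * (t ^ 2 / (1 + x * t) ^ 2)
        - 2 * (t ^ 2 / (1 + x * t) ^ 1)) has_integral 0) {0..1}"
    by simp
  moreover have "((\<lambda>t. 2 * (t ^ 1 / (1 + x * t) ^ 1) - (1 + x) * (t ^ 2 / (1 + x * t) ^ 2)
        - 2 * (t ^ 2 / (1 + x * t) ^ 1)) has_integral
      2 * kernel_integral 1 1 x - (1 + x) * kernel_integral 2 2 x - 2 * kernel_integral 2 1 x) {0..1}"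
    by (intro has_integral_diff has_integral_mult_right has_integral_kernel assms)
  ultimately have "0 = 2 * kernel_integral 1 1 x - (1 + x) * kernel_integral 2 2 x - 2 * kernel_integral 2 1 x"
    by (rule has_integral_unique)
  then show ?thesis by simp
qed

text \<open>Although the kernel itself decreases in \<open>x\<close>, the weight
  \<open>1 + x\<close> wins pointwise: comparing \<open>(1 + x) / (1 + x * t)\<close> at
  \<open>x\<close> and \<open>y\<close> by cross multiplication leaves
  \<open>(y - x) * (1 - t)\<close>, which is nonnegative.\<close>

lemma kernel_integral_mono_weighted:
  assumes "-1 < x" "x \<le> y"
  shows "(1 + x) * kernel_integral n 1 x \<le> (1 + y) * kernel_integral n 1 y"
proof (rule has_integral_le)
  show "((\<lambda>t. (1 + x) * (t ^ n / (1 + x * t) ^ 1)) has_integral (1 + x) * kernel_integral n 1 x) {0..1}"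
    "((\<lambda>t. (1 + y) * (t ^ n / (1 + y * t) ^ 1)) has_integral (1 + y) * kernel_integral n 1 y) {0..1}"
    by (intro has_integral_mult_right has_integral_kernel; use assms in simp)+
  fix t :: real assume t: "t \<in> {0..1}"
  have "(1 + x) * (1 + y * t) \<le> (1 + y) * (1 + x * t)"
    using mult_nonneg_nonneg [of "y - x" "1 - t"] assms t by (auto simp: algebra_simps)
  then have "(1 + x) / (1 + x * t) \<le> (1 + y) / (1 + y * t)"
    using kernel_pos [of x t] kernel_pos [of y t] assms t by (simp add: divide_simps)
  then have "t ^ n * ((1 + x) / (1 + x * t)) \<le> t ^ n * ((1 + y) / (1 + y * t))"
    using t by (intro mult_left_mono) auto
  then show "(1 + x) * (t ^ n / (1 + x * t) ^ 1) \<le> (1 + y) * (t ^ n / (1 + y * t) ^ 1)"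
    by (simp add: mult_ac)
qed

lemma kernel_integral_01_antimono:
  assumes "-1 < x" "x \<le> y"
  shows "kernel_integral 0 1 y \<le> kernel_integral 0 1 x"
proof (rule has_integral_le)
  show "((\<lambda>t. t ^ 0 / (1 + y * t) ^ 1) has_integral kernel_integral 0 1 y) {0..1}"
    "((\<lambda>t. t ^ 0 / (1 + x * t) ^ 1) has_integral kernel_integral 0 1 x) {0..1}"
    using assms has_integral_kernel [of y 0 1] has_integral_kernel [of x 0 1] by linarith+
  fix t :: real assume t: "t \<in> {0..1}"
  have "1 + x * t \<le> 1 + y * t"
    using assms t by (auto intro: mult_right_mono)
  then show "t ^ 0 / (1 + y * t) ^ 1 \<le> t ^ 0 / (1 + x * t) ^ 1"
    using kernel_pos [of x t] assms t by (auto intro!: divide_left_mono mult_pos_pos)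
qed

lemma kernel_integral_01_le_1:
  assumes "0 \<le> x"
  shows "kernel_integral 0 1 x \<le> 1"
  using kernel_integral_01_antimono [of 0 x] assms by (simp add: kernel_integral_def)

lemma continuous_on_kernel_integral: "continuous_on {-1<..} (kernel_integral n k)"
  by (intro continuous_at_imp_continuous_on ballI) (auto intro: DERIV_isCont DERIV_kernel_integral)

section \<open>A global coordinate on \<open>x > -1\<close> in which the inner potential is a
  parabola\<close>

section \<open>The coordinate linearising the inner oscillation\<close>

text \<open>The square root of \<open>2 * (x - ln (1 + x))\<close> carrying the sign of
  \<open>x\<close>; this is the coordinate h. Pulling out the factor \<open>x\<close> makes it
  differentiable and increasing through the minimum at \<open>x = 0\<close>.\<close>

definition lin_coord :: "real \<Rightarrow> real" where
  "lin_coord x = x * sqrt (2 * kernel_integral 1 1 x)"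

lemma lin_coord_power2:
  assumes "-1 < x"
  shows "(lin_coord x)\<^sup>2 = 2 * (x - ln (1 + x))"
  using kernel_integral_diff_ln [OF assms] kernel_integral_pos [OF assms, of 1 1]
  by (simp add: lin_coord_def power_mult_distrib)

lemma DERIV_sqrt_kernel_integral:
  assumes "-1 < x"
  shows "((\<lambda>x. sqrt (2 * kernel_integral 1 1 x)) has_real_derivative
      - kernel_integral 2 2 x / sqrt (2 * kernel_integral 1 1 x)) (at x)"
proof -
  have "0 < 2 * kernel_integral 1 1 x"
    using kernel_integral_pos [OF assms, of 1 1] by simp
  from DERIV_real_sqrt [OF this]
  have "((\<lambda>x. sqrt (2 * kernel_integral 1 1 x)) has_real_derivative
      inverse (sqrt (2 * kernel_integral 1 1 x)) / 2 * (2 * - (real 1 * kernel_integral (Suc 1) (Suc 1) x))) (at x)"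
    by (rule DERIV_chain2) (intro DERIV_cmult DERIV_kernel_integral assms)
  then show ?thesis
    by (simp add: field_simps numeral_2_eq_2)
qed

text \<open>Differentiating the square of h gives h h' = x / (1 + x), which degenerates at the
  minimum. In the kernel form the factor \<open>x\<close> has been divided out, and
  \<open>kernel_integral_11_22\<close> evaluates the remaining numerator as
  \<open>1 / (1 + x)\<close>.\<close>

lemma DERIV_lin_coord:
  assumes "-1 < x"
  shows "(lin_coord has_real_derivative 1 / ((1 + x) * sqrt (2 * kernel_integral 1 1 x))) (at x)"
proof -
  define r where "r = sqrt (2 * kernel_integral 1 1 x)"
  have r: "0 < r" "r\<^sup>2 = 2 * kernel_integral 1 1 x"
    using kernel_integral_pos [OF assms, of 1 1] by (auto simp: r_def)
  have "(lin_coord has_real_derivative x * (- kernel_integral 2 2 x / r) + 1 * r) (at x)"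
    unfolding lin_coord_def [abs_def] r_def
    by (rule DERIV_mult' [OF DERIV_ident DERIV_sqrt_kernel_integral [OF assms]])
  moreover have "x * (- kernel_integral 2 2 x / r) + 1 * r = (r\<^sup>2 - x * kernel_integral 2 2 x) / r"
    using r(1) by (simp add: field_simps power2_eq_square)
  moreover have "\<dots> = 1 / ((1 + x) * r)"
    using kernel_integral_11_22 [OF assms] r by simp
  ultimately show ?thesis
    by (simp add: r_def)
qed

lemma lin_coord_strict_mono: "strict_mono_on {-1<..} lin_coord"
  by (rule DERIV_pos_imp_strict_mono_on [OF _ DERIV_lin_coord])
    (auto intro!: mult_pos_pos kernel_integral_pos)

lemma continuous_on_lin_coord: "continuous_on {-1<..} lin_coord"
  by (intro continuous_at_imp_continuous_on ballI) (auto intro: DERIV_isCont DERIV_lin_coord)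

lemma lin_coord_surj: "\<exists>x>-1. lin_coord x = r"
proof (cases "0 \<le> r")
  case True
  \<comment> \<open>Chosen so that \<open>ln (1 + b) = 2 * ln (1 + r)\<close> is at most
    \<open>2 * r\<close>, whence \<open>b - ln (1 + b)\<close> is at least \<open>r\<^sup>2\<close>
    and \<open>lin_coord b\<close> overshoots \<open>r\<close>.\<close>
  define b where "b = (1 + r)\<^sup>2 - 1"
  have b: "0 \<le> b" using True by (simp add: b_def power2_eq_square algebra_simps)
  have "ln ((1 + r)\<^sup>2) = 2 * ln (1 + r)"
    using True by (simp add: ln_realpow)
  also have "\<dots> \<le> 2 * r"
    using ln_add_one_self_le_self [OF True] by simp
  finally have "r\<^sup>2 \<le> b - ln (1 + b)"
    by (simp add: b_def power2_eq_square algebra_simps)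
  also have "\<dots> \<le> 2 * (b - ln (1 + b))"
    using order_trans [OF zero_le_power2 calculation] by simp
  also have "\<dots> = (lin_coord b)\<^sup>2"
    using lin_coord_power2 [of b] b by simp
  finally have "r\<^sup>2 \<le> (lin_coord b)\<^sup>2" .
  then have "r \<le> lin_coord b"
    by (rule power2_le_imp_le) (use b kernel_integral_pos [of b 1 1] in \<open>auto simp: lin_coord_def\<close>)
  moreover have "lin_coord 0 \<le> r" using True by (simp add: lin_coord_def)
  moreover have "continuous_on {0..b} lin_coord"
    by (rule continuous_on_subset [OF continuous_on_lin_coord]) auto
  ultimately obtain x where "0 \<le> x" "lin_coord x = r"
    using IVT' [of lin_coord 0 r b] b by blast
  then show ?thesis by (intro exI [of _ x]) auto
next
  case False
  \<comment> \<open>Close enough to the logarithmic singularity at -1: here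
    \<open>- ln (1 + b) = 1 + r\<^sup>2\<close>, so \<open>b - ln (1 + b)\<close> exceeds
    \<open>r\<^sup>2\<close>. Both values being nonpositive, the squares are compared after
    negation.\<close>
  define b where "b = exp (- 1 - r\<^sup>2) - 1"
  have b: "-1 < b" "b \<le> 0" by (auto simp: b_def intro: order_trans [OF _ zero_le_power2])
  have "r\<^sup>2 \<le> 2 * (b - ln (1 + b))"
    by (simp add: b_def)
  also have "\<dots> = (lin_coord b)\<^sup>2"
    using lin_coord_power2 [of b] b by simp
  finally have "(- r)\<^sup>2 \<le> (- lin_coord b)\<^sup>2" by simp
  then have "- r \<le> - lin_coord b"
    by (rule power2_le_imp_le)
      (use b kernel_integral_pos [of b 1 1] in \<open>auto simp: lin_coord_def mult_le_0_iff\<close>)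
  moreover have "r \<le> lin_coord 0" using False by (simp add: lin_coord_def)
  moreover have "continuous_on {b..0} lin_coord"
    by (rule continuous_on_subset [OF continuous_on_lin_coord]) (use b in auto)
  ultimately obtain x where "b \<le> x" "lin_coord x = r"
    using IVT' [of lin_coord b r 0] b by auto
  then show ?thesis using b by (intro exI [of _ x]) auto
qed

definition lin_inv :: "real \<Rightarrow> real" where
  "lin_inv = the_inv_into {-1<..} lin_coord"

lemma lin_coord_inj: "inj_on lin_coord {-1<..}"
  using lin_coord_strict_mono by (rule strict_mono_on_imp_inj_on)

lemma lin_inv_lin_coord: "-1 < x \<Longrightarrow> lin_inv (lin_coord x) = x"
  by (simp add: lin_inv_def the_inv_into_f_f lin_coord_inj)

lemma lin_inv_gt: "-1 < lin_inv r" and lin_coord_lin_inv: "lin_coord (lin_inv r) = r"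
  using lin_coord_surj [of r] lin_inv_lin_coord by auto

lemma lin_inv_strict_mono: "strict_mono lin_inv"
proof (rule strict_monoI)
  fix r s :: real assume "r < s"
  then show "lin_inv r < lin_inv s"
    using strict_mono_on_leD [OF lin_coord_strict_mono, of "lin_inv s" "lin_inv r"]
    by (force simp: lin_inv_gt lin_coord_lin_inv not_less [symmetric])
qed

lemma DERIV_lin_inv:
  "(lin_inv has_real_derivative (1 + lin_inv r) * sqrt (2 * kernel_integral 1 1 (lin_inv r))) (at r)"
proof -
  let ?x = "lin_inv r"
  let ?d = "1 / ((1 + ?x) * sqrt (2 * kernel_integral 1 1 ?x))"
  have d: "?d \<noteq> 0" using lin_inv_gt [of r] kernel_integral_pos [of ?x 1 1] by simp
  have "(lin_inv has_derivative (*) (inverse ?d)) (at (lin_coord ?x))"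
    by (rule has_derivative_inverse_strong [OF open_greaterThan _ continuous_on_lin_coord lin_inv_lin_coord])
      (use DERIV_lin_coord [OF lin_inv_gt [of r]] d lin_inv_gt [of r] in
        \<open>auto simp: has_field_derivative_def fun_eq_iff\<close>)
  then show ?thesis
    by (simp add: has_field_derivative_def lin_coord_lin_inv)
qed

lemma lin_inv_0: "lin_inv 0 = 0"
  using lin_inv_lin_coord [of 0] by (simp add: lin_coord_def)

lemma lin_coord_pos: "0 < x \<Longrightarrow> 0 < lin_coord x"
  using strict_mono_onD [OF lin_coord_strict_mono, of 0 x] by (simp add: lin_coord_def)

lemma lin_coord_neg: "-1 < x \<Longrightarrow> x < 0 \<Longrightarrow> lin_coord x < 0"
  using strict_mono_onD [OF lin_coord_strict_mono, of x 0] by (simp add: lin_coord_def)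

lemma lin_inv_less_iff: "lin_inv r < lin_inv s \<longleftrightarrow> r < s"
  by (rule strict_mono_less [OF lin_inv_strict_mono])

section \<open>The inner period in the angle variable and its growth with the amplitude\<close>

section \<open>Inner orbits\<close>

text \<open>With \<open>\<phi>\<^sup>2 = \<omega> - (1 - \<omega>) * x\<close> one gets
  \<open>1 - \<phi>\<^sup>2 = (1 - \<omega>) * (1 + x)\<close>, so the factor
  \<open>1 - \<omega>\<close> cancels inside the logarithm and \<open>lin_coord_power2\<close>
  applies. The minimum \<open>sqrt \<omega>\<close> of the potential is at
  \<open>x = 0\<close>.\<close>

lemma potential_lin_coord:
  assumes "\<omega> < 1" "-1 < x" "(1 - \<omega>) * x \<le> \<omega>"
  shows "potential \<omega> (sqrt (\<omega> - (1 - \<omega>) * x)) = (1 - \<omega>) / 4 * (lin_coord x)\<^sup>2"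
proof -
  have 1: "1 - (\<omega> - (1 - \<omega>) * x) = (1 - \<omega>) * (1 + x)"
    by (simp add: algebra_simps)
  have 2: "ln ((1 - \<omega>) / ((1 - \<omega>) * (1 + x))) = - ln (1 + x)"
    using assms by (simp add: ln_div)
  show ?thesis
    unfolding potential_def using assms
    by (simp only: real_sqrt_pow2 diff_ge_0_iff_ge 1 2 lin_coord_power2) (simp add: field_simps)
qed

text \<open>The point \<phi> = 0 is \<open>x = \<omega> / (1 - \<omega>)\<close>. Its
  \<open>lin_coord\<close> is therefore the critical amplitude, the upper bound for the amplitudes
  \<open>r\<close> of inner orbits.\<close>

lemma crit_energy_lin_coord:
  assumes "0 < \<omega>" "\<omega> < 1"
  shows "crit_energy \<omega> = (1 - \<omega>) / 4 * (lin_coord (\<omega> / (1 - \<omega>)))\<^sup>2"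
  using potential_lin_coord [of \<omega> "\<omega> / (1 - \<omega>)"] assms
  by (simp add: crit_energy_def less_divide_eq)

lemma lin_inv_bound:
  assumes "\<omega> < 1" "r < lin_coord (\<omega> / (1 - \<omega>))"
  shows "(1 - \<omega>) * lin_inv r < \<omega>"
proof -
  have "lin_inv r < lin_inv (lin_coord (\<omega> / (1 - \<omega>)))"
    using assms by (simp add: lin_inv_less_iff)
  moreover have "-1 < \<omega> / (1 - \<omega>)" using assms by (simp add: less_divide_eq)
  ultimately show ?thesis
    using assms by (simp add: lin_inv_lin_coord field_simps)
qed

text \<open>The energy fixes h up to sign, so the turning points lie at h = r and h = -r. Since
  \<phi> decreases as \<open>x\<close> grows, the positive sign belongs to the smaller root.\<close>

lemma inner_turning_points:
  assumes w: "0 < \<omega>" "\<omega> < 1" and r: "0 < r" "r < lin_coord (\<omega> / (1 - \<omega>))"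
  shows "inner_min \<omega> ((1 - \<omega>) / 4 * r\<^sup>2) = sqrt (\<omega> - (1 - \<omega>) * lin_inv r)"
    and "inner_max \<omega> ((1 - \<omega>) / 4 * r\<^sup>2) = sqrt (\<omega> - (1 - \<omega>) * lin_inv (- r))"
proof -
  have pos: "0 < lin_inv r" and neg: "lin_inv (- r) < 0"
    using lin_inv_less_iff [of 0 r] lin_inv_less_iff [of "- r" 0] r by (simp_all add: lin_inv_0)
  have posm: "0 < (1 - \<omega>) * lin_inv r" and negm: "(1 - \<omega>) * lin_inv (- r) < 0"
    using pos neg w by (auto simp: mult_less_0_iff)
  have bound: "(1 - \<omega>) * lin_inv r < \<omega>"
    by (rule lin_inv_bound) (use w r in auto)
  \<comment> \<open>Every root of the energy equation in (0, 1) comes from some \<open>x\<close>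
    with \<open>lin_coord x\<close> equal to \<open>r\<close> or \<open>- r\<close>. Uniqueness then
    only needs the sign of \<open>x\<close>, decided by the side of \<open>sqrt \<omega>\<close> on
    which the root lies.\<close>
  have inv: "\<exists>x>-1. (1 - \<omega>) * x = \<omega> - m\<^sup>2 \<and> m = sqrt (\<omega> - (1 - \<omega>) * x) \<and> (lin_coord x)\<^sup>2 = r\<^sup>2"
    if m: "0 < m" "m < 1" "potential \<omega> m = (1 - \<omega>) / 4 * r\<^sup>2" for m
  proof -
    define x where "x = (\<omega> - m\<^sup>2) / (1 - \<omega>)"
    have "m\<^sup>2 < 1" using m by (simp add: power_less_one_iff)
    then have x: "-1 < x" "(1 - \<omega>) * x = \<omega> - m\<^sup>2"
      using w by (auto simp: x_def less_divide_eq)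
    then have "m = sqrt (\<omega> - (1 - \<omega>) * x)" using m by simp
    note x = x this
    have "(1 - \<omega>) / 4 * (lin_coord x)\<^sup>2 = (1 - \<omega>) / 4 * r\<^sup>2"
      using potential_lin_coord [of \<omega> x] w x(1,2) m by simp
    then show ?thesis using w x by (intro exI [of _ x]) (simp only: mult_cancel_left, simp)
  qed
  show "inner_min \<omega> ((1 - \<omega>) / 4 * r\<^sup>2) = sqrt (\<omega> - (1 - \<omega>) * lin_inv r)"
    unfolding inner_min_def
  proof (rule the_equality)
    show "0 < sqrt (\<omega> - (1 - \<omega>) * lin_inv r) \<and> sqrt (\<omega> - (1 - \<omega>) * lin_inv r) < sqrt \<omega> \<and>
        potential \<omega> (sqrt (\<omega> - (1 - \<omega>) * lin_inv r)) = (1 - \<omega>) / 4 * r\<^sup>2"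
      using potential_lin_coord [of \<omega> "lin_inv r"] w posm bound lin_inv_gt [of r]
      by (simp add: lin_coord_lin_inv)
    fix m assume m: "0 < m \<and> m < sqrt \<omega> \<and> potential \<omega> m = (1 - \<omega>) / 4 * r\<^sup>2"
    have m2: "m\<^sup>2 < \<omega>" using m w power_strict_mono [of m "sqrt \<omega>" 2] by simp
    have "sqrt \<omega> < 1" using w by simp
    with m obtain x where x: "-1 < x" "(1 - \<omega>) * x = \<omega> - m\<^sup>2" "m = sqrt (\<omega> - (1 - \<omega>) * x)"
      "(lin_coord x)\<^sup>2 = r\<^sup>2"
      using inv [of m] less_trans [of m "sqrt \<omega>" 1] by blast
    have "0 < (1 - \<omega>) * x" using m2 x(2) by simp
    then have "0 < x" using w by (simp add: zero_less_mult_iff)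
    then have "lin_coord x = r"
      using x(4) r lin_coord_pos [of x] by (simp add: power2_eq_iff)
    then show "m = sqrt (\<omega> - (1 - \<omega>) * lin_inv r)"
      using x(3) lin_inv_lin_coord [OF x(1)] by simp
  qed
  show "inner_max \<omega> ((1 - \<omega>) / 4 * r\<^sup>2) = sqrt (\<omega> - (1 - \<omega>) * lin_inv (- r))"
    unfolding inner_max_def
  proof (rule the_equality)
    have "(1 - \<omega>) * (1 + lin_inv (- r)) > 0"
      using w lin_inv_gt [of "- r"] by simp
    then have "\<omega> - (1 - \<omega>) * lin_inv (- r) < 1" by (simp add: algebra_simps)
    then show "sqrt \<omega> < sqrt (\<omega> - (1 - \<omega>) * lin_inv (- r)) \<and> sqrt (\<omega> - (1 - \<omega>) * lin_inv (- r)) < 1 \<and>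
        potential \<omega> (sqrt (\<omega> - (1 - \<omega>) * lin_inv (- r))) = (1 - \<omega>) / 4 * r\<^sup>2"
      using potential_lin_coord [of \<omega> "lin_inv (- r)"] w negm lin_inv_gt [of "- r"]
      by (simp add: lin_coord_lin_inv)
    fix m assume m: "sqrt \<omega> < m \<and> m < 1 \<and> potential \<omega> m = (1 - \<omega>) / 4 * r\<^sup>2"
    have m2: "\<omega> < m\<^sup>2" using m w power_strict_mono [of "sqrt \<omega>" m 2] by simp
    have "0 < m" using m w less_trans [of 0 "sqrt \<omega>" m] by simp
    with m obtain x where x: "-1 < x" "(1 - \<omega>) * x = \<omega> - m\<^sup>2" "m = sqrt (\<omega> - (1 - \<omega>) * x)"
      "(lin_coord x)\<^sup>2 = r\<^sup>2"
      using inv [of m] by blast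
    have "(1 - \<omega>) * x < 0" using m2 x(2) by simp
    then have "x < 0" using w by (simp add: mult_less_0_iff)
    then have "lin_coord x = - r"
      using x(1,4) r lin_coord_neg [of x] by (auto simp: power2_eq_iff)
    then show "m = sqrt (\<omega> - (1 - \<omega>) * lin_inv (- r))"
      using x(3) lin_inv_lin_coord [OF x(1)] by simp
  qed
qed

text \<open>Evaluated at \<open>x = lin_inv h\<close>, this is the derivative of \<phi> with respect
  to h, freed of the negative factor \<open>- (1 - \<omega>) / 2\<close>.\<close>

definition inner_density :: "real \<Rightarrow> real \<Rightarrow> real" where
  "inner_density \<omega> x = (1 + x) * sqrt (2 * kernel_integral 1 1 x) / sqrt (\<omega> - (1 - \<omega>) * x)"

text \<open>The derivative is taken in h, not in \<open>x\<close>. The terms are grouped into the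
  weighted kernels of \<open>kernel_integral_mono_weighted\<close>, over powers of a square root
  that decreases in \<open>x\<close>.\<close>

definition inner_density_deriv :: "real \<Rightarrow> real \<Rightarrow> real" where
  "inner_density_deriv \<omega> x =
     2 * ((1 + x) * kernel_integral 2 1 x) / sqrt (\<omega> - (1 - \<omega>) * x) +
     (1 - \<omega>) * ((1 + x) * ((1 + x) * kernel_integral 1 1 x)) / sqrt (\<omega> - (1 - \<omega>) * x) ^ 3"

lemma DERIV_inner_amplitude:
  assumes "\<omega> < 1" "h < lin_coord (\<omega> / (1 - \<omega>))"
  shows "((\<lambda>h. sqrt (\<omega> - (1 - \<omega>) * lin_inv h)) has_real_derivative
      - (1 - \<omega>) / 2 * inner_density \<omega> (lin_inv h)) (at h)"
proof -
  have "0 < \<omega> - (1 - \<omega>) * lin_inv h" using lin_inv_bound [OF assms] by simp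
  from DERIV_real_sqrt [OF this]
  have "((\<lambda>h. sqrt (\<omega> - (1 - \<omega>) * lin_inv h)) has_real_derivative
      inverse (sqrt (\<omega> - (1 - \<omega>) * lin_inv h)) / 2 *
      (0 - (1 - \<omega>) * ((1 + lin_inv h) * sqrt (2 * kernel_integral 1 1 (lin_inv h))))) (at h)"
    by (rule DERIV_chain2) (intro DERIV_diff DERIV_const DERIV_cmult DERIV_lin_inv)
  then show ?thesis
    by (simp add: inner_density_def field_simps)
qed

lemma DERIV_inner_density:
  assumes "\<omega> < 1" "h < lin_coord (\<omega> / (1 - \<omega>))"
  shows "((\<lambda>h. inner_density \<omega> (lin_inv h)) has_real_derivative
      inner_density_deriv \<omega> (lin_inv h)) (at h)"
proof -
  define x where "x = lin_inv h"
  define s where "s = sqrt (2 * kernel_integral 1 1 x)"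
  define q where "q = sqrt (\<omega> - (1 - \<omega>) * x)"
  have x: "-1 < x" by (simp add: x_def lin_inv_gt)
  have s: "0 < s" "s\<^sup>2 = 2 * kernel_integral 1 1 x"
    using kernel_integral_pos [OF x, of 1 1] by (auto simp: s_def)
  have q: "0 < q" using lin_inv_bound [OF assms] by (simp add: q_def x_def)
  have ds: "((\<lambda>h. sqrt (2 * kernel_integral 1 1 (lin_inv h))) has_real_derivative
      - kernel_integral 2 2 x / s * ((1 + x) * s)) (at h)"
    unfolding s_def x_def
    by (rule DERIV_chain2 [OF DERIV_sqrt_kernel_integral DERIV_lin_inv]) (rule lin_inv_gt)
  have "((\<lambda>h. (1 + lin_inv h) * sqrt (2 * kernel_integral 1 1 (lin_inv h))) has_real_derivative
      (1 + x) * (- kernel_integral 2 2 x / s * ((1 + x) * s)) + (0 + (1 + x) * s) * s) (at h)"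
    using DERIV_mult' [OF DERIV_add [OF DERIV_const [of 1] DERIV_lin_inv] ds]
    by (simp add: x_def s_def)
  moreover have "(1 + x) * (- kernel_integral 2 2 x / s * ((1 + x) * s)) + (0 + (1 + x) * s) * s
      = (1 + x) * (s\<^sup>2 - (1 + x) * kernel_integral 2 2 x)"
    using s(1) by (simp add: field_simps power2_eq_square)
  \<comment> \<open>Here the competing terms of the product rule are replaced by one positive
    kernel, which makes the later monotonicity visible.\<close>
  moreover have "\<dots> = 2 * ((1 + x) * kernel_integral 2 1 x)"
    using kernel_integral_11_22_21 [OF x] s(2) by simp
  ultimately have "((\<lambda>h. (1 + lin_inv h) * sqrt (2 * kernel_integral 1 1 (lin_inv h))) has_real_derivative
      2 * ((1 + x) * kernel_integral 2 1 x)) (at h)"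
    by simp
  from DERIV_divide [OF this DERIV_inner_amplitude [OF assms]] q
  have "((\<lambda>h. inner_density \<omega> (lin_inv h)) has_real_derivative
      (2 * ((1 + x) * kernel_integral 2 1 x) * q
        - (1 + x) * s * (- (1 - \<omega>) / 2 * ((1 + x) * s / q))) / (q * q)) (at h)"
    by (simp add: inner_density_def x_def s_def q_def)
  moreover have "(2 * ((1 + x) * kernel_integral 2 1 x) * q
        - (1 + x) * s * (- (1 - \<omega>) / 2 * ((1 + x) * s / q))) / (q * q)
      = 2 * ((1 + x) * kernel_integral 2 1 x) / q + (1 - \<omega>) * ((1 + x) * ((1 + x) * (s\<^sup>2 / 2))) / q ^ 3"
    using q by (simp add: divide_simps) (simp add: algebra_simps power2_eq_square power3_eq_cube)
  ultimately show ?thesis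
    using s(2) by (simp add: inner_density_deriv_def x_def q_def)
qed

lemma continuous_on_inner_density:
  assumes "\<omega> < 1"
  shows "continuous_on {..<lin_coord (\<omega> / (1 - \<omega>))} (\<lambda>h. inner_density \<omega> (lin_inv h))"
  by (intro continuous_at_imp_continuous_on ballI)
    (use assms in \<open>auto intro: DERIV_isCont DERIV_inner_density\<close>)

text \<open>Both summands have positive, nondecreasing numerators and positive, nonincreasing
  denominators; the extra factor \<open>1 + x\<close> makes the second numerator strictly
  increasing. This is the monotonicity of the second derivative of \<phi> in h on which the inner
  result rests.\<close>

lemma inner_density_deriv_less:
  assumes "\<omega> < 1" "-1 < x" "x < y" "(1 - \<omega>) * y < \<omega>"
  shows "inner_density_deriv \<omega> x < inner_density_deriv \<omega> y"
proof -
  have "(1 - \<omega>) * x < (1 - \<omega>) * y" using assms by simp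
  then have q: "0 < sqrt (\<omega> - (1 - \<omega>) * y)" "sqrt (\<omega> - (1 - \<omega>) * y) \<le> sqrt (\<omega> - (1 - \<omega>) * x)"
    using assms by auto
  have K: "0 < kernel_integral n 1 x" and Ky: "0 < kernel_integral n 1 y" for n
    using kernel_integral_pos assms by auto
  have m: "(1 + x) * kernel_integral n 1 x \<le> (1 + y) * kernel_integral n 1 y" for n
    using kernel_integral_mono_weighted assms by simp
  have "2 * ((1 + x) * kernel_integral 2 1 x) / sqrt (\<omega> - (1 - \<omega>) * x)
      \<le> 2 * ((1 + y) * kernel_integral 2 1 y) / sqrt (\<omega> - (1 - \<omega>) * y)"
    using m [of 2] q K [of 2] Ky [of 2] assms by (intro frac_le) auto
  moreover have "(1 + x) * ((1 + x) * kernel_integral 1 1 x) < (1 + y) * ((1 + y) * kernel_integral 1 1 y)"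
    using m [of 1] K [of 1] assms by (intro mult_less_le_imp_less) auto
  then have "(1 - \<omega>) * ((1 + x) * ((1 + x) * kernel_integral 1 1 x)) / sqrt (\<omega> - (1 - \<omega>) * x) ^ 3
      < (1 - \<omega>) * ((1 + y) * ((1 + y) * kernel_integral 1 1 y)) / sqrt (\<omega> - (1 - \<omega>) * y) ^ 3"
    using q K [of 1] assms by (intro frac_less power_mono) auto
  ultimately show ?thesis
    unfolding inner_density_deriv_def by linarith
qed

lemma continuous_on_inner_density_deriv:
  assumes "\<omega> < 1"
  shows "continuous_on {x. -1 < x \<and> (1 - \<omega>) * x < \<omega>} (inner_density_deriv \<omega>)"
  unfolding inner_density_deriv_def [abs_def]
  by (intro continuous_intros continuous_on_subset [OF continuous_on_kernel_integral]) auto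

text \<open>For h = r sin \<theta> the quantity under the root is a constant times
  \<open>(r * cos \<theta>)\<^sup>2\<close>, and its root cancels the factor
  \<open>r * cos \<theta>\<close> produced by the substitution.\<close>

lemma period_inner:
  assumes w: "0 < \<omega>" "\<omega> < 1" and r: "0 < r" "r < lin_coord (\<omega> / (1 - \<omega>))"
  shows "period \<omega> ((1 - \<omega>) / 4 * r\<^sup>2) = 2 * sqrt ((1 - \<omega>) / 2) *
    integral {-(pi/2)..pi/2} (\<lambda>\<theta>. inner_density \<omega> (lin_inv (r * sin \<theta>)))"
proof -
  define c where "c = sqrt ((1 - \<omega>) / 2)"
  have c: "0 < c" "2 * c\<^sup>2 = 1 - \<omega>" using w by (auto simp: c_def)
  let ?E = "(1 - \<omega>) / 4 * r\<^sup>2"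
  let ?f = "\<lambda>\<phi>. 1 / sqrt (2 * (?E - potential \<omega> \<phi>))"
  \<comment> \<open>The angle enters as \<open>- \<theta>\<close> because \<phi> decreases in h,
    whereas the substitution lemma asks for an increasing \<open>g\<close>. A reflection of the
    angle interval undoes this at the end.\<close>
  define g where "g = (\<lambda>\<theta>. sqrt (\<omega> - (1 - \<omega>) * lin_inv (r * sin (- \<theta>))))"
  have h: "r * sin \<theta> < lin_coord (\<omega> / (1 - \<omega>))" for \<theta>
  proof -
    have "r * sin \<theta> \<le> r" by (rule mult_left_le) (use r in auto)
    then show ?thesis using r by linarith
  qed
  have dg: "(g has_real_derivative (1 - \<omega>) / 2 * inner_density \<omega> (lin_inv (r * sin (- \<theta>))) * (r * cos \<theta>)) (at \<theta>)" for \<theta>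
  proof -
    have "((\<lambda>\<theta>. r * sin (- \<theta>)) has_real_derivative - (r * cos \<theta>)) (at \<theta>)"
      by (auto intro!: derivative_eq_intros)
    from DERIV_chain2 [OF DERIV_inner_amplitude [OF w(2) h] this] show ?thesis
      unfolding g_def by (rule DERIV_cong) (simp add: field_simps)
  qed
  have dens: "continuous_on S (\<lambda>\<theta>. inner_density \<omega> (lin_inv (r * sin (- \<theta>))))" for S
    by (rule continuous_on_compose2 [OF continuous_on_inner_density [OF w(2)]])
      (use h in \<open>auto intro!: continuous_intros simp flip: sin_minus\<close>)
  have dpos: "0 < inner_density \<omega> (lin_inv (r * sin \<theta>))" for \<theta>
    unfolding inner_density_def
  proof (intro divide_pos_pos mult_pos_pos)
    show "0 < 1 + lin_inv (r * sin \<theta>)"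
      using lin_inv_gt [of "r * sin \<theta>"] by linarith
  qed (use lin_inv_bound [OF w(2) h] lin_inv_gt in \<open>auto intro: kernel_integral_pos\<close>)
  have "integral {g (- (pi/2))..g (pi/2)} ?f =
      integral {-(pi/2)..pi/2} (\<lambda>\<theta>. c * inner_density \<omega> (lin_inv (r * sin (- \<theta>))))"
  proof (rule integral_substitution_Ioo)
    show "continuous_on {-(pi/2)..pi/2} g"
      using dg by (intro continuous_at_imp_continuous_on ballI) (auto intro: DERIV_isCont)
    show "continuous_on {-(pi/2)..pi/2} (\<lambda>\<theta>. c * inner_density \<omega> (lin_inv (r * sin (- \<theta>))))"
      by (intro continuous_intros dens)
    fix \<theta> assume \<theta>: "\<theta> \<in> {-(pi/2)<..<pi/2}"
    then have cos: "0 < cos \<theta>" by (auto intro: cos_gt_zero_pi)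
    show "0 < (1 - \<omega>) / 2 * inner_density \<omega> (lin_inv (r * sin (- \<theta>))) * (r * cos \<theta>)"
      using cos dpos [of "- \<theta>"] w r by simp
    have "potential \<omega> (g \<theta>) = (1 - \<omega>) / 4 * (r * sin \<theta>)\<^sup>2"
      using potential_lin_coord [of \<omega> "lin_inv (r * sin (- \<theta>))"] lin_inv_bound [OF w(2) h [of "- \<theta>"]] w
      by (simp add: g_def lin_inv_gt lin_coord_lin_inv)
    then have "2 * (?E - potential \<omega> (g \<theta>)) = (1 - \<omega>) / 2 * (r\<^sup>2 * (1 - (sin \<theta>)\<^sup>2))"
      by (simp only:) (simp add: field_simps)
    also have "\<dots> = (c * (r * cos \<theta>))\<^sup>2"
      by (simp add: c(2) [symmetric] cos_squared_eq power_mult_distrib)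
    finally have "?f (g \<theta>) = 1 / (c * (r * cos \<theta>))"
      using c r cos by simp
    then show "(1 - \<omega>) / 2 * inner_density \<omega> (lin_inv (r * sin (- \<theta>))) * (r * cos \<theta>) * ?f (g \<theta>)
        = c * inner_density \<omega> (lin_inv (r * sin (- \<theta>)))"
      using c r cos by (simp add: c(2) [symmetric] power2_eq_square)
  qed (use dg in auto)
  also have "\<dots> = c * integral {-(pi/2)..pi/2} (\<lambda>\<theta>. inner_density \<omega> (lin_inv (r * sin (- \<theta>))))"
    by simp
  also have "integral {-(pi/2)..pi/2} (\<lambda>\<theta>. inner_density \<omega> (lin_inv (r * sin (- \<theta>))))
      = integral {-(pi/2)..pi/2} (\<lambda>\<theta>. inner_density \<omega> (lin_inv (r * sin \<theta>)))"
    using Henstock_Kurzweil_Integration.integral_reflect_real [of "pi/2" "-(pi/2)" "\<lambda>\<theta>. inner_density \<omega> (lin_inv (r * sin \<theta>))"]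
    by (simp del: Henstock_Kurzweil_Integration.integral_reflect_real sin_minus)
  finally have *: "integral {g (- (pi/2))..g (pi/2)} ?f =
      c * integral {-(pi/2)..pi/2} (\<lambda>\<theta>. inner_density \<omega> (lin_inv (r * sin \<theta>)))" .
  have "?E < crit_energy \<omega>"
    using w r by (simp add: crit_energy_lin_coord power_strict_mono)
  moreover have "0 < ?E" using w r by simp
  moreover have "g (- (pi/2)) = inner_min \<omega> ?E" "g (pi/2) = inner_max \<omega> ?E"
    using inner_turning_points [OF w r] by (simp_all add: g_def)
  ultimately show ?thesis
    using w * unfolding period_def by (simp only: c_def) simp
qed

text \<open>Everything is proved in the amplitude \<open>r\<close>, where \<open>I\<close> is the
  period up to a positive factor, and carried over by the increasing bijection \<open>e\<close> from
  amplitudes to energies.\<close>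

lemma period_inner_C1_strict_mono:
  assumes w: "0 < \<omega>" "\<omega> < 1"
  shows "period \<omega> C1_differentiable_on {0<..<crit_energy \<omega>}"
    and "strict_mono_on {0<..<crit_energy \<omega>} (period \<omega>)"
proof -
  define R where "R = lin_coord (\<omega> / (1 - \<omega>))"
  have R: "0 < R" using w by (simp add: R_def lin_coord_pos)
  define X where "X = {0<..<R}"
  define e where "e = (\<lambda>r::real. (1 - \<omega>) / 4 * r\<^sup>2)"
  define c where "c = 2 * sqrt ((1 - \<omega>) / 2)"
  have c: "0 < c" using w by (simp add: c_def)
  define I where "I = (\<lambda>r. integral {-(pi/2)..pi/2} (\<lambda>\<theta>. inner_density \<omega> (lin_inv (r * sin \<theta>))))"
  define I' where "I' = (\<lambda>r. integral {-(pi/2)..pi/2} (\<lambda>\<theta>. inner_density_deriv \<omega> (lin_inv (r * sin \<theta>)) * sin \<theta>))"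
  have h: "r * sin \<theta> < R" if "r \<in> X" for r \<theta>
  proof -
    have "r * sin \<theta> \<le> r" by (rule mult_left_le) (use that in \<open>auto simp: X_def\<close>)
    moreover have "r < R" using that by (simp add: X_def)
    ultimately show ?thesis by linarith
  qed
  have bound: "(1 - \<omega>) * lin_inv (r * sin \<theta>) < \<omega>" if "r \<in> X" for r \<theta>
    using lin_inv_bound [OF w(2), of "r * sin \<theta>"] h [OF that] by (simp add: R_def)
  have dd: "((\<lambda>r. inner_density \<omega> (lin_inv (r * sin \<theta>))) has_real_derivative
      inner_density_deriv \<omega> (lin_inv (r * sin \<theta>)) * sin \<theta>) (at r)" if "r \<in> X" for r \<theta>
    by (rule DERIV_chain2 [OF DERIV_inner_density])
      (use w h [OF that] in \<open>auto simp: R_def intro!: derivative_eq_intros\<close>)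
  have cont_inv: "continuous_on UNIV lin_inv"
    by (intro continuous_at_imp_continuous_on ballI) (rule DERIV_isCont [OF DERIV_lin_inv])
  have contD: "continuous_on (X \<times> {-(pi/2)..pi/2})
      (\<lambda>(r, \<theta>). inner_density_deriv \<omega> (lin_inv (r * sin \<theta>)) * sin \<theta>)"
    unfolding split_beta
    by (intro continuous_intros continuous_on_compose2 [OF continuous_on_inner_density_deriv [OF w(2)]]
        continuous_on_compose2 [OF cont_inv]) (auto simp: lin_inv_gt bound)
  have contG: "continuous_on {-(pi/2)..pi/2} (\<lambda>\<theta>. inner_density \<omega> (lin_inv (r * sin \<theta>)))"
    if "r \<in> X" for r
    by (rule continuous_on_compose2 [OF continuous_on_inner_density [OF w(2)]])
      (use h [OF that] in \<open>auto simp: R_def intro!: continuous_intros\<close>)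
  have dI: "(I has_real_derivative I' r) (at r)" if "r \<in> X" for r
    unfolding I_def I'_def
    by (rule leibniz_C1(1) [OF _ _ dd contG contD that]) (auto simp: X_def)
  have cI: "continuous_on X I'"
    unfolding I'_def by (rule leibniz_C1(2) [OF _ _ dd contG contD]) (auto simp: X_def)
  have I'pos: "0 < I' r" if r: "r \<in> X" for r
  proof -
    let ?D = "\<lambda>\<theta>. inner_density_deriv \<omega> (lin_inv (r * sin \<theta>))"
    have cont1: "continuous_on {-(pi/2)..pi/2} (\<lambda>\<theta>. ?D \<theta> * sin \<theta>)"
    proof -
      have "continuous_on {-(pi/2)..pi/2} (\<lambda>\<theta>. (r, \<theta>))" by (intro continuous_intros)
      from continuous_on_compose2 [OF contD this] r show ?thesis by auto
    qed
    have cont2: "continuous_on {-(pi/2)..pi/2} (\<lambda>\<theta>. inner_density_deriv \<omega> 0 * sin \<theta>)"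
      by (intro continuous_intros)
    \<comment> \<open>The factor \<open>sin \<theta>\<close> changes sign, so the integrand of
      \<open>I'\<close> has no evident sign. Subtracting its multiple of \<open>sin \<theta>\<close>
      with the value at h = 0, which integrates to 0, leaves a product of two factors of equal
      sign.\<close>
    have sgn: "0 < ?D \<theta> * sin \<theta> - inner_density_deriv \<omega> 0 * sin \<theta>" if "sin \<theta> \<noteq> 0" for \<theta>
    proof (cases "0 < sin \<theta>")
      case True
      then have "0 < lin_inv (r * sin \<theta>)"
        using lin_inv_less_iff [of 0 "r * sin \<theta>"] r by (simp add: lin_inv_0 X_def)
      then have "inner_density_deriv \<omega> 0 < ?D \<theta>"
        using inner_density_deriv_less w bound [OF r] by simp
      then show ?thesis using True by (simp add: left_diff_distrib [symmetric])
    next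
      case False
      then have neg: "sin \<theta> < 0" using that by simp
      then have "lin_inv (r * sin \<theta>) < 0"
        using lin_inv_less_iff [of "r * sin \<theta>" 0] r by (simp add: lin_inv_0 X_def mult_less_0_iff)
      then have "?D \<theta> < inner_density_deriv \<omega> 0"
        using inner_density_deriv_less w lin_inv_gt by simp
      then show ?thesis using neg by (simp add: left_diff_distrib [symmetric] zero_less_mult_iff)
    qed
    have "integral {-(pi/2)..pi/2} (\<lambda>\<theta>. inner_density_deriv \<omega> 0 * sin \<theta>) = 0"
    proof (rule integral_unique)
      have "(sin has_integral - cos (pi/2) - - cos (-(pi/2))) {-(pi/2)..pi/2}"
        by (rule fundamental_theorem_of_calculus)
          (auto simp: has_real_derivative_iff_has_vector_derivative [symmetric] intro!: derivative_eq_intros)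
      then show "((\<lambda>\<theta>. inner_density_deriv \<omega> 0 * sin \<theta>) has_integral 0) {-(pi/2)..pi/2}"
        using has_integral_mult_right [of sin 0 "{-(pi/2)..pi/2}"] by simp
    qed
    then have "I' r = integral {-(pi/2)..pi/2} (\<lambda>\<theta>. ?D \<theta> * sin \<theta> - inner_density_deriv \<omega> 0 * sin \<theta>)"
      unfolding I'_def using cont1 cont2 by (subst integral_diff) (auto intro: integrable_continuous_real)
    also have "0 < \<dots>"
    proof (rule integral_pos [where c = "pi/2"])
      show "continuous_on {-(pi/2)..pi/2} (\<lambda>\<theta>. ?D \<theta> * sin \<theta> - inner_density_deriv \<omega> 0 * sin \<theta>)"
        by (intro continuous_on_diff cont1 cont2)
      show "0 \<le> ?D \<theta> * sin \<theta> - inner_density_deriv \<omega> 0 * sin \<theta>" for \<theta>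
        using sgn [of \<theta>] by (cases "sin \<theta> = 0") auto
      show "?D (pi/2) * sin (pi/2) - inner_density_deriv \<omega> 0 * sin (pi/2) \<noteq> 0"
        using sgn [of "pi/2"] by simp
    qed auto
    finally show ?thesis .
  qed
  have de: "(e has_real_derivative (1 - \<omega>) / 2 * r) (at r)" for r
    unfolding e_def by (auto intro!: derivative_eq_intros)
  have crit: "crit_energy \<omega> = e R"
    using crit_energy_lin_coord [OF w] by (simp add: e_def R_def)
  \<comment> \<open>Taken on the whole half-line rather than on \<open>X\<close>, so that amplitudes
    can also be compared with the end point \<open>R\<close> when the image is computed.\<close>
  have e_mono: "strict_mono_on {0..} e"
    using w by (auto intro!: strict_mono_onI power_strict_mono simp: e_def)
  have img: "e ` X = {0<..<crit_energy \<omega>}"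
  proof
    show "e ` X \<subseteq> {0<..<crit_energy \<omega>}"
      using strict_mono_onD [OF e_mono] w by (auto simp: X_def crit) (simp add: e_def)
    show "{0<..<crit_energy \<omega>} \<subseteq> e ` X"
    proof
      fix E assume E: "E \<in> {0<..<crit_energy \<omega>}"
      define r where "r = sqrt (4 * E / (1 - \<omega>))"
      have r: "0 < r" "e r = E" using E w by (auto simp: r_def e_def)
      then have "r < R"
        using E crit strict_mono_on_leD [OF e_mono, of R r] R by (cases "r < R") auto
      with r show "E \<in> e ` X" by (auto simp: X_def)
    qed
  qed
  have f: "period \<omega> (e r) = c * I r" if "r \<in> X" for r
    using period_inner [OF w, of r] that by (simp add: X_def R_def e_def c_def I_def)
  have "period \<omega> C1_differentiable_on (e ` X)"
  proof (rule C1_differentiable_on_reparam [where e = e and e' = "\<lambda>r. (1 - \<omega>) / 2 * r"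
        and S = "\<lambda>r. c * I r" and S' = "\<lambda>r. c * I' r"])
    show "((\<lambda>r. c * I r) has_real_derivative c * I' r) (at r)" if "r \<in> X" for r
      by (intro DERIV_cmult dI that)
    show "continuous_on X (\<lambda>r. c * I' r)" by (intro continuous_intros cI)
    show "inj_on e X"
      by (rule inj_on_subset [OF strict_mono_on_imp_inj_on [OF e_mono]]) (auto simp: X_def)
    show "(e has_real_derivative (1 - \<omega>) / 2 * r) (at r)" for r by (rule de)
  qed (use f w in \<open>auto simp: X_def img [unfolded X_def] intro!: continuous_intros\<close>)
  then show "period \<omega> C1_differentiable_on {0<..<crit_energy \<omega>}" by (simp add: img)
  have "strict_mono_on X I"
    by (rule DERIV_pos_imp_strict_mono_on [OF _ dI I'pos]) (auto simp: X_def)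
  then have I_mono: "r < s \<Longrightarrow> I r < I s" if "r \<in> X" "s \<in> X" for r s
    using that by (auto dest: strict_mono_onD)
  show "strict_mono_on {0<..<crit_energy \<omega>} (period \<omega>)"
    unfolding img [symmetric]
  proof (rule strict_mono_onI)
    fix E F assume "E \<in> e ` X" "F \<in> e ` X" "E < F"
    then obtain r s where rs: "r \<in> X" "s \<in> X" "E = e r" "F = e s" by auto
    have "r < s"
      using strict_mono_on_leD [OF e_mono, of s r] rs \<open>E < F\<close> by (cases "r < s") (auto simp: X_def)
    then show "period \<omega> E < period \<omega> F"
      using rs f I_mono c by simp
  qed
qed

section \<open>The outer period in the angle variable and its decay in the turning point parameter
  B\<close>

section \<open>Outer orbits\<close>

text \<open>The function H, with \<open>k\<close> in place of the squared cosine. It is the part of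
  the kinetic energy left after splitting off the factor that vanishes at the turning point.\<close>

definition outer_factor :: "real \<Rightarrow> real \<Rightarrow> real \<Rightarrow> real" where
  "outer_factor \<omega> B k = (1 - \<omega>) * ((1 + B) * kernel_integral 0 1 (B * k)) - 1"

definition outer_factor_deriv :: "real \<Rightarrow> real \<Rightarrow> real \<Rightarrow> real" where
  "outer_factor_deriv \<omega> B k =
     (1 - \<omega>) * (kernel_integral 0 1 (B * k) - (1 + B) * (k * kernel_integral 1 2 (B * k)))"

lemma DERIV_outer_factor:
  assumes "0 \<le> B" "0 \<le> k"
  shows "((\<lambda>B. outer_factor \<omega> B k) has_real_derivative outer_factor_deriv \<omega> B k) (at B)"
proof -
  have "0 \<le> B * k" using assms by simp
  then have "-1 < B * k" by linarith
  from DERIV_kernel_integral [OF this, of 0 1]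
  have "((\<lambda>B. kernel_integral 0 1 (B * k)) has_real_derivative - kernel_integral 1 2 (B * k) * k) (at B)"
    by (rule DERIV_chain2 [THEN DERIV_cong])
      (auto intro!: derivative_eq_intros simp: numeral_2_eq_2)
  then have "((\<lambda>B. (1 - \<omega>) * ((1 + B) * kernel_integral 0 1 (B * k)) - 1) has_real_derivative
      (1 - \<omega>) * ((1 + B) * (- kernel_integral 1 2 (B * k) * k) + (0 + 1) * kernel_integral 0 1 (B * k)) - 0) (at B)"
    by (intro DERIV_diff DERIV_cmult DERIV_mult' DERIV_add DERIV_const DERIV_ident)
  then show ?thesis
    unfolding outer_factor_def by (rule DERIV_cong) (simp add: outer_factor_deriv_def algebra_simps)
qed

lemma DERIV_inverse_sqrt:
  fixes u :: real
  assumes "0 < u"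
  shows "((\<lambda>u. 1 / sqrt u) has_real_derivative - (1 / (2 * u * sqrt u))) (at u)"
  using assms by (auto intro!: derivative_eq_intros simp: divide_simps)

text \<open>With \<open>x = B * k\<close> the coefficient \<open>(1 + B) * k\<close> is
  \<open>k + x\<close>, and the two kernels combine to the integral of
  \<open>(1 - k * t) / (1 + x * t)\<^sup>2\<close>, which is nonnegative on the unit interval and
  equal to 1 at \<open>t = 0\<close>.\<close>

lemma outer_factor_deriv_pos:
  assumes "\<omega> < 1" "0 \<le> B" "0 \<le> k" "k \<le> 1"
  shows "0 < outer_factor_deriv \<omega> B k"
proof -
  define x where "x = B * k"
  have "0 \<le> x" using assms by (simp add: x_def)
  then have x: "-1 < x" by simp
  let ?f = "\<lambda>t. t ^ 0 / (1 + x * t) ^ 1 - (k + x) * (t ^ 1 / (1 + x * t) ^ 2)"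
  have "(?f has_integral kernel_integral 0 1 x - (k + x) * kernel_integral 1 2 x) {0..1}"
    by (intro has_integral_diff has_integral_mult_right has_integral_kernel x)
  then have eq: "kernel_integral 0 1 x - (k + x) * kernel_integral 1 2 x = integral {0..1} ?f"
    by (simp only: integral_unique)
  have "0 < integral {0..1} ?f"
  proof (rule integral_pos [where c = 0])
    show "continuous_on {0..1} ?f"
      by (intro continuous_on_diff continuous_on_mult continuous_on_const continuous_on_kernel x)
    fix t :: real assume t: "t \<in> {0..1}"
    have "?f t = (1 - k * t) / (1 + x * t) ^ 2"
      using kernel_pos [OF x t] by (simp add: divide_simps power2_eq_square) (simp add: algebra_simps)
    moreover have "k * t \<le> 1" using t assms by (simp add: mult_le_one)
    ultimately show "0 \<le> ?f t" by simp
  qed auto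
  with eq have "0 < kernel_integral 0 1 x - (k + x) * kernel_integral 1 2 x" by simp
  then have "0 < (1 - \<omega>) * (kernel_integral 0 1 x - (k + x) * kernel_integral 1 2 x)"
    using assms by simp
  also have "\<dots> = outer_factor_deriv \<omega> B k"
    by (simp add: outer_factor_deriv_def x_def algebra_simps)
  finally show ?thesis .
qed

lemma outer_factor_strict_mono:
  assumes "\<omega> < 1" "0 \<le> k" "k \<le> 1"
  shows "strict_mono_on {0..} (\<lambda>B. outer_factor \<omega> B k)"
  by (rule DERIV_pos_imp_strict_mono_on [OF _ DERIV_outer_factor outer_factor_deriv_pos])
    (use assms in auto)

text \<open>The value \<open>k = 1\<close> belongs to the crossing of \<phi> = 0. The factor is
  smallest there, so positivity along the whole orbit reduces to this single value.\<close>

lemma outer_factor_antimono: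
  assumes "\<omega> < 1" "0 \<le> B" "0 \<le> k" "k \<le> 1"
  shows "outer_factor \<omega> B 1 \<le> outer_factor \<omega> B k"
proof -
  have "0 \<le> B * k" "B * k \<le> B * 1" using assms by (auto intro: mult_left_le)
  then have "kernel_integral 0 1 (B * 1) \<le> kernel_integral 0 1 (B * k)"
    by (intro kernel_integral_01_antimono) auto
  then show ?thesis
    using assms by (simp add: outer_factor_def)
qed

lemma continuous_on_outer_factor:
  fixes f g :: "'a::topological_space \<Rightarrow> real"
  assumes "continuous_on S f" "continuous_on S g"
    and "\<And>x. x \<in> S \<Longrightarrow> 0 \<le> f x" "\<And>x. x \<in> S \<Longrightarrow> 0 \<le> g x"
  shows "continuous_on S (\<lambda>x. outer_factor \<omega> (f x) (g x))"
    and "continuous_on S (\<lambda>x. outer_factor_deriv \<omega> (f x) (g x))"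
proof -
  have K: "continuous_on S (\<lambda>x. kernel_integral n k (f x * g x))" for n k
  proof (rule continuous_on_compose2 [OF continuous_on_kernel_integral])
    show "(\<lambda>x. f x * g x) ` S \<subseteq> {-1<..}"
      using assms(3,4) by (auto intro: less_le_trans [of _ 0])
  qed (intro continuous_intros assms)
  show "continuous_on S (\<lambda>x. outer_factor \<omega> (f x) (g x))"
    unfolding outer_factor_def by (intro continuous_intros assms K)
  show "continuous_on S (\<lambda>x. outer_factor_deriv \<omega> (f x) (g x))"
    unfolding outer_factor_deriv_def by (intro continuous_intros assms K)
qed

text \<open>The potential at the turning point M, written in \<open>B\<close>: here M^2 is
  \<open>B / (1 + B)\<close> and 1 - M^2 is \<open>1 / (1 + B)\<close>, so the logarithm
  splits.\<close>

definition outer_energy :: "real \<Rightarrow> real \<Rightarrow> real" where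
  "outer_energy \<omega> B = (\<omega> - B / (1 + B)) / 2 + (1 - \<omega>) / 2 * (ln (1 - \<omega>) + ln (1 + B))"

text \<open>Read \<open>s\<close> as sin \<theta> and \<open>k\<close> as its squared cosine. Then 1
  - \<phi>^2 is \<open>(1 + B * k) / (1 + B)\<close>, the logarithms differ by
  \<open>ln (1 + B * k)\<close>, and \<open>kernel_integral_ln\<close> pulls \<open>B * k\<close>
  out of it. The cases \<open>k = 1\<close> and \<open>k = 0\<close> give the origin and the turning
  point.\<close>

lemma outer_energy_minus_potential:
  assumes "\<omega> < 1" "0 \<le> B" "0 \<le> k" "s\<^sup>2 + k = 1"
  shows "outer_energy \<omega> B - potential \<omega> (sqrt (B / (1 + B)) * s)
    = B / (1 + B) * k / 2 * outer_factor \<omega> B k"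
proof -
  define x where "x = B * k"
  define K where "K = kernel_integral 0 1 x"
  have x: "0 \<le> x" using assms by (simp add: x_def)
  have A: "(sqrt (B / (1 + B)) * s)\<^sup>2 = B / (1 + B) * (1 - k)"
    using assms by (simp add: power_mult_distrib eq_diff_eq)
  have "1 - B / (1 + B) * (1 - k) = (1 + x) / (1 + B)"
    using assms by (simp add: x_def field_simps)
  then have L: "ln ((1 - \<omega>) / (1 - B / (1 + B) * (1 - k))) = ln (1 - \<omega>) + ln (1 + B) - ln (1 + x)"
    using assms x by (simp add: ln_div ln_mult)
  have "outer_energy \<omega> B - potential \<omega> (sqrt (B / (1 + B)) * s)
      = - (B / (1 + B)) * k / 2 + (1 - \<omega>) / 2 * ln (1 + x)"
    unfolding outer_energy_def potential_def A L
    by (simp add: algebra_simps diff_divide_distrib add_divide_distrib)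
  also have "ln (1 + x) = B * k * K"
    using kernel_integral_ln [of x] x by (simp add: x_def K_def)
  also have "- (B / (1 + B)) * k / 2 + (1 - \<omega>) / 2 * (B * k * K)
      = B / (1 + B) * k / 2 * ((1 - \<omega>) * ((1 + B) * K) - 1)"
    using assms by (simp add: field_simps)
  also have "(1 - \<omega>) * ((1 + B) * K) - 1 = outer_factor \<omega> B k"
    by (simp add: outer_factor_def K_def x_def)
  finally show ?thesis .
qed

lemma outer_energy_crit:
  assumes "\<omega> < 1" "0 \<le> B"
  shows "outer_energy \<omega> B - crit_energy \<omega> = B / (1 + B) / 2 * outer_factor \<omega> B 1"
  using outer_energy_minus_potential [of \<omega> B 1 0] assms by (simp add: crit_energy_def)

lemma potential_outer_energy:
  assumes "\<omega> < 1" "0 \<le> B"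
  shows "potential \<omega> (sqrt (B / (1 + B))) = outer_energy \<omega> B"
  using outer_energy_minus_potential [of \<omega> B 0 1] assms by simp

text \<open>The parameters whose energy exceeds the critical one, as \<open>outer_range_iff\<close>
  shows. The encoding by a factor that increases in \<open>B\<close> makes the set upward closed,
  hence an interval, and open.\<close>

definition outer_range :: "real \<Rightarrow> real set" where
  "outer_range \<omega> = {B. 0 < B \<and> 0 < outer_factor \<omega> B 1}"

lemma outer_range_iff:
  assumes "\<omega> < 1" "0 \<le> B"
  shows "B \<in> outer_range \<omega> \<longleftrightarrow> crit_energy \<omega> < outer_energy \<omega> B"
  using outer_energy_crit [OF assms] assms
  by (cases "B = 0") (auto simp: outer_range_def zero_less_mult_iff zero_less_divide_iff
      simp flip: diff_gt_0_iff_gt [of "outer_energy \<omega> B"])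

lemma outer_range_convex_open:
  assumes "\<omega> < 1"
  shows "convex (outer_range \<omega>)" "open (outer_range \<omega>)"
proof -
  have "y \<in> outer_range \<omega>" if "x \<in> outer_range \<omega>" "x \<le> y" for x y
    using that strict_mono_on_leD [OF outer_factor_strict_mono [OF assms, of 1], of x y]
    by (auto simp: outer_range_def)
  then have "is_interval (outer_range \<omega>)"
    by (auto simp: is_interval_1)
  then show "convex (outer_range \<omega>)" by (simp add: is_interval_convex_1)
  have "open ({0<..} \<inter> (\<lambda>B. outer_factor \<omega> B 1) -` {0<..})"
    by (rule continuous_open_preimage) (auto intro!: continuous_on_outer_factor continuous_intros)
  also have "{0<..} \<inter> (\<lambda>B. outer_factor \<omega> B 1) -` {0<..} = outer_range \<omega>"
    by (auto simp: outer_range_def)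
  finally show "open (outer_range \<omega>)" .
qed

lemma outer_factor_pos:
  assumes "\<omega> < 1" "B \<in> outer_range \<omega>" "0 \<le> k" "k \<le> 1"
  shows "0 < outer_factor \<omega> B k"
  using outer_factor_antimono [of \<omega> B k] assms by (auto simp: outer_range_def)

lemma DERIV_outer_energy:
  assumes "0 \<le> B"
  shows "(outer_energy \<omega> has_real_derivative ((1 - \<omega>) * (1 + B) - 1) / (2 * (1 + B)\<^sup>2)) (at B)"
proof -
  define u where "u = 1 + B"
  have u: "0 < u" "B = u - 1" using assms by (auto simp: u_def)
  have "(outer_energy \<omega> has_real_derivative
      (0 - (1 * u - B * (0 + 1)) / (u * u)) / 2 + (1 - \<omega>) / 2 * (0 + 1 / u * (0 + 1))) (at B)"
    unfolding outer_energy_def [abs_def] u_def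
    using assms
    by (intro DERIV_add DERIV_cdivide DERIV_diff DERIV_const DERIV_divide DERIV_ident DERIV_cmult
        DERIV_chain2 [OF DERIV_ln_divide]) auto
  moreover have "(0 - (1 * u - B * (0 + 1)) / (u * u)) / 2 + (1 - \<omega>) / 2 * (0 + 1 / u * (0 + 1))
      = ((1 - \<omega>) * u - 1) / (2 * u\<^sup>2)"
    using u(1) unfolding u(2) by (simp add: divide_simps power2_eq_square)
  ultimately show ?thesis by (simp add: u_def)
qed

text \<open>Membership in the range says
  \<open>1 < (1 - \<omega>) * (1 + B) * kernel_integral 0 1 B\<close>. The kernel is at most 1 for
  nonnegative \<open>B\<close>, so dropping it keeps the inequality.\<close>

lemma outer_energy_deriv_pos:
  assumes "\<omega> < 1" "B \<in> outer_range \<omega>"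
  shows "0 < ((1 - \<omega>) * (1 + B) - 1) / (2 * (1 + B)\<^sup>2)"
proof -
  have B: "0 < B" "1 < (1 - \<omega>) * (1 + B) * kernel_integral 0 1 B"
    using assms by (auto simp: outer_range_def outer_factor_def mult.assoc)
  have "(1 - \<omega>) * (1 + B) * kernel_integral 0 1 B \<le> (1 - \<omega>) * (1 + B) * 1"
    using kernel_integral_01_le_1 [of B] assms B by (intro mult_left_mono) auto
  with B show ?thesis by simp
qed

lemma outer_energy_strict_mono:
  assumes "\<omega> < 1"
  shows "strict_mono_on (outer_range \<omega>) (outer_energy \<omega>)"
  by (rule DERIV_pos_imp_strict_mono_on [OF outer_range_convex_open(1) [OF assms]
        DERIV_outer_energy outer_energy_deriv_pos [OF assms]])
    (auto simp: outer_range_def)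

lemma outer_energy_image:
  assumes w: "\<omega> < 1"
  shows "outer_energy \<omega> ` outer_range \<omega> = {crit_energy \<omega><..}"
proof
  show "outer_energy \<omega> ` outer_range \<omega> \<subseteq> {crit_energy \<omega><..}"
  proof (rule image_subsetI)
    fix B assume B: "B \<in> outer_range \<omega>"
    then have "0 \<le> B" by (simp add: outer_range_def)
    with B show "outer_energy \<omega> B \<in> {crit_energy \<omega><..}"
      using outer_range_iff [OF w] by simp
  qed
  show "{crit_energy \<omega><..} \<subseteq> outer_energy \<omega> ` outer_range \<omega>"
  proof
    fix E assume E: "E \<in> {crit_energy \<omega><..}"
    \<comment> \<open>The constant \<open>c\<close> solves the energy equation after
      \<open>B / (1 + B)\<close> is replaced by its bound 1 and \<open>ln (1 + B)\<close> by
      \<open>c\<close>. Taking \<open>b\<close> with \<open>ln (1 + b) = \<bar>c\<bar>\<close> gives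
      a nonnegative parameter of energy at least \<open>E\<close>, ready for the intermediate value
      theorem.\<close>
    define c where "c = (2 * E - \<omega> + 1) / (1 - \<omega>) - ln (1 - \<omega>)"
    define b where "b = exp \<bar>c\<bar> - 1"
    have b: "0 \<le> b" by (simp add: b_def)
    have "E = (\<omega> - 1) / 2 + (1 - \<omega>) / 2 * (ln (1 - \<omega>) + c)"
      using w by (simp add: c_def field_simps)
    also have "\<dots> \<le> (\<omega> - b / (1 + b)) / 2 + (1 - \<omega>) / 2 * (ln (1 - \<omega>) + \<bar>c\<bar>)"
      using w b by (intro add_mono mult_left_mono divide_right_mono) (auto simp: divide_le_eq)
    also have "\<dots> = outer_energy \<omega> b"
      by (simp add: outer_energy_def b_def)
    finally have "E \<le> outer_energy \<omega> b" .
    moreover have "outer_energy \<omega> 0 \<le> E"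
      using E outer_energy_crit [OF w, of 0] by simp
    moreover have "continuous_on {0..b} (outer_energy \<omega>)"
      by (intro continuous_at_imp_continuous_on ballI) (auto intro: DERIV_isCont DERIV_outer_energy)
    ultimately obtain B where "0 \<le> B" "outer_energy \<omega> B = E"
      using IVT' [of "outer_energy \<omega>" 0 E b] b by blast
    then show "E \<in> outer_energy \<omega> ` outer_range \<omega>"
      using outer_range_iff [OF w, of B] E by auto
  qed
qed

lemma outer_turning_point:
  assumes w: "\<omega> < 1" and B: "B \<in> outer_range \<omega>"
  shows "outer_max \<omega> (outer_energy \<omega> B) = sqrt (B / (1 + B))"
  unfolding outer_max_def
proof (rule the_equality)
  have "0 < B" using B by (simp add: outer_range_def)
  then show "0 < sqrt (B / (1 + B)) \<and> sqrt (B / (1 + B)) < 1 \<and>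
      potential \<omega> (sqrt (B / (1 + B))) = outer_energy \<omega> B"
    using potential_outer_energy [OF w] by simp
  fix M assume M: "0 < M \<and> M < 1 \<and> potential \<omega> M = outer_energy \<omega> B"
  \<comment> \<open>Any competing root is the turning point of its own parameter \<open>C\<close>.
    Equal energies put \<open>C\<close> into the range, and injectivity of the energy there forces
    \<open>C = B\<close>.\<close>
  define C where "C = M\<^sup>2 / (1 - M\<^sup>2)"
  have "M\<^sup>2 < 1" using M by (simp add: power_less_one_iff)
  then have C: "0 < C" "C / (1 + C) = M\<^sup>2" using M by (auto simp: C_def field_simps)
  then have M': "M = sqrt (C / (1 + C))" using M by simp
  then have eq: "outer_energy \<omega> C = outer_energy \<omega> B"
    using potential_outer_energy [OF w, of C] C(1) M by simp
  then have "C \<in> outer_range \<omega>"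
    using outer_range_iff [OF w, of C] outer_range_iff [OF w, of B] B C \<open>0 < B\<close> by simp
  then have "C = B"
    using strict_mono_on_imp_inj_on [OF outer_energy_strict_mono [OF w]] B eq
    by (auto dest: inj_onD)
  then show "M = sqrt (B / (1 + B))" using M' by simp
qed

text \<open>Under \<phi> = a sin \<theta>, with \<open>a\<close> the turning point,
  \<open>2 * (?E - potential \<omega> \<phi>)\<close> contains the square of
  \<open>a * cos \<theta>\<close>, which cancels the derivative of the substitution and leaves a
  continuous integrand.\<close>

lemma period_outer:
  assumes w: "\<omega> < 1" and B: "B \<in> outer_range \<omega>"
  shows "period \<omega> (outer_energy \<omega> B) =
    4 * integral {0..pi/2} (\<lambda>\<theta>. 1 / sqrt (outer_factor \<omega> B ((cos \<theta>)\<^sup>2)))"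
proof -
  let ?E = "outer_energy \<omega> B"
  let ?f = "\<lambda>\<phi>. 1 / sqrt (2 * (?E - potential \<omega> \<phi>))"
  define a where "a = sqrt (B / (1 + B))"
  have B0: "0 < B" using B by (simp add: outer_range_def)
  then have a: "0 < a" "a\<^sup>2 = B / (1 + B)" by (auto simp: a_def)
  have F: "0 < outer_factor \<omega> B ((cos \<theta>)\<^sup>2)" for \<theta>
    by (rule outer_factor_pos [OF w B]) (auto simp: abs_square_le_1)
  have "integral {a * sin 0..a * sin (pi/2)} ?f
      = integral {0..pi/2} (\<lambda>\<theta>. 1 / sqrt (outer_factor \<omega> B ((cos \<theta>)\<^sup>2)))"
  proof (rule integral_substitution_Ioo)
    show "((\<lambda>\<theta>. a * sin \<theta>) has_real_derivative a * cos \<theta>) (at \<theta>)" for \<theta>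
      by (auto intro!: derivative_eq_intros)
    show "continuous_on {0..pi/2} (\<lambda>\<theta>. a * sin \<theta>)" by (intro continuous_intros)
    show "continuous_on {0..pi/2} (\<lambda>\<theta>. 1 / sqrt (outer_factor \<omega> B ((cos \<theta>)\<^sup>2)))"
      using F [THEN less_imp_neq] B0
      by (intro continuous_intros continuous_on_outer_factor) (auto simp: eq_commute [of 0])
    fix \<theta> assume \<theta>: "\<theta> \<in> {0<..<pi/2}"
    then have cos: "0 < cos \<theta>" by (auto intro: cos_gt_zero)
    then show "0 < a * cos \<theta>" using a by simp
    have "?E - potential \<omega> (a * sin \<theta>) = a\<^sup>2 * (cos \<theta>)\<^sup>2 / 2 * outer_factor \<omega> B ((cos \<theta>)\<^sup>2)"
      using outer_energy_minus_potential [of \<omega> B "(cos \<theta>)\<^sup>2" "sin \<theta>"] w B0 a(1)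
      by (simp only: a_def [symmetric] a(2) [symmetric]) simp
    then have "2 * (?E - potential \<omega> (a * sin \<theta>)) = (a * cos \<theta>)\<^sup>2 * outer_factor \<omega> B ((cos \<theta>)\<^sup>2)"
      by (simp add: power_mult_distrib)
    then have "?f (a * sin \<theta>) = 1 / (a * cos \<theta> * sqrt (outer_factor \<omega> B ((cos \<theta>)\<^sup>2)))"
      using a(1) cos by (simp add: real_sqrt_mult)
    then show "a * cos \<theta> * ?f (a * sin \<theta>) = 1 / sqrt (outer_factor \<omega> B ((cos \<theta>)\<^sup>2))"
      using a(1) cos by simp
  qed simp
  moreover have "crit_energy \<omega> < ?E"
    using outer_range_iff [OF w, of B] B B0 by simp
  ultimately show ?thesis
    using w outer_turning_point [OF w B] by (simp add: period_def a_def)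
qed

text \<open>In contrast to the inner case the integrand is already monotone in the parameter at each
  fixed angle, because \<open>outer_factor\<close> increases in \<open>B\<close> and enters through
  its inverse square root. The sign of the derivative is thus read off pointwise.\<close>

lemma period_outer_C1_strict_antimono:
  assumes w: "\<omega> < 1"
  shows "period \<omega> C1_differentiable_on {crit_energy \<omega><..}"
    and "strict_antimono_on {crit_energy \<omega><..} (period \<omega>)"
proof -
  define X where "X = outer_range \<omega>"
  let ?F = "\<lambda>B \<theta>. outer_factor \<omega> B ((cos \<theta>)\<^sup>2)"
  let ?F' = "\<lambda>B \<theta>. outer_factor_deriv \<omega> B ((cos \<theta>)\<^sup>2)"
  define g where "g = (\<lambda>B \<theta>. 1 / sqrt (?F B \<theta>))"
  define g' where "g' = (\<lambda>B \<theta>. - (?F' B \<theta> / (2 * ?F B \<theta> * sqrt (?F B \<theta>))))"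
  have X: "convex X" "open X" using outer_range_convex_open [OF w] by (auto simp: X_def)
  have pos: "0 < B" if "B \<in> X" for B using that by (simp add: X_def outer_range_def)
  have F: "0 < ?F B \<theta>" if "B \<in> X" for B \<theta>
    by (rule outer_factor_pos [OF w]) (use that in \<open>auto simp: X_def abs_square_le_1\<close>)
  have F_nz: "?F B \<theta> \<noteq> 0" if "B \<in> X" for B \<theta>
    using F [OF that, of \<theta>] by simp
  have F': "0 < ?F' B \<theta>" if "B \<in> X" for B \<theta>
    by (rule outer_factor_deriv_pos [OF w]) (use pos [OF that] in \<open>auto simp: abs_square_le_1\<close>)
  have dg: "((\<lambda>B. g B \<theta>) has_real_derivative g' B \<theta>) (at B)" if "B \<in> X" for B \<theta>
  proof -
    have "((\<lambda>B. ?F B \<theta>) has_real_derivative ?F' B \<theta>) (at B)"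
      by (rule DERIV_outer_factor) (use pos [OF that] in auto)
    from DERIV_chain2 [OF DERIV_inverse_sqrt [OF F [OF that]] this] show ?thesis
      by (simp add: g_def g'_def)
  qed
  have cg: "continuous_on {0..pi/2} (g B)" if "B \<in> X" for B
    unfolding g_def using F_nz [OF that] pos [OF that]
    by (intro continuous_intros continuous_on_outer_factor) auto
  have cg': "continuous_on (X \<times> {0..pi/2}) (\<lambda>(B, \<theta>). g' B \<theta>)"
    unfolding g'_def split_beta
    by (intro continuous_intros continuous_on_outer_factor) 
      (auto simp: F_nz less_imp_le [OF pos])
  define I where "I = (\<lambda>B. integral {0..pi/2} (g B))"
  define I' where "I' = (\<lambda>B. integral {0..pi/2} (g' B))"
  have dI: "(I has_real_derivative I' B) (at B)" if "B \<in> X" for B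
    unfolding I_def I'_def by (rule leibniz_C1(1) [OF X(2,1) dg cg cg' that])
  have cI: "continuous_on X I'"
    unfolding I'_def by (rule leibniz_C1(2) [OF X(2,1) dg cg cg'])
  \<comment> \<open>Phrased with a minus sign so that the criterion for increasing functions can be
    applied to \<open>- I\<close>.\<close>
  have I'neg: "0 < - I' B" if B: "B \<in> X" for B
  proof -
    have "0 < integral {0..pi/2} (\<lambda>\<theta>. - g' B \<theta>)"
    proof (rule integral_pos [where c = 0])
      show "continuous_on {0..pi/2} (\<lambda>\<theta>. - g' B \<theta>)"
      proof -
        have "continuous_on {0..pi/2} (\<lambda>\<theta>. (B, \<theta>))" by (intro continuous_intros)
        from continuous_on_compose2 [OF cg' this] B show ?thesis
          by (auto intro!: continuous_on_minus)
      qed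
      have "0 < - g' B \<theta>" for \<theta>
        using F [OF B, of \<theta>] F' [OF B, of \<theta>] by (simp add: g'_def)
      then show "0 \<le> - g' B \<theta>" "- g' B 0 \<noteq> 0" for \<theta>
        by (metis less_imp_le, metis less_irrefl)
    qed auto
    then show ?thesis by (simp add: I'_def)
  qed
  have e: "outer_energy \<omega> ` X = {crit_energy \<omega><..}"
    using outer_energy_image [OF w] by (simp add: X_def)
  have f: "period \<omega> (outer_energy \<omega> B) = 4 * I B" if "B \<in> X" for B
    using period_outer [OF w, of B] that by (simp add: X_def I_def g_def)
  have e_mono: "strict_mono_on X (outer_energy \<omega>)"
    using outer_energy_strict_mono [OF w] by (simp add: X_def)
  have "period \<omega> C1_differentiable_on (outer_energy \<omega> ` X)"
  proof (rule C1_differentiable_on_reparam [OF X(2) _ strict_mono_on_imp_inj_on [OF e_mono]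
        DERIV_outer_energy _ _ DERIV_cmult [OF dI]])
    show "((1 - \<omega>) * (1 + B) - 1) / (2 * (1 + B)\<^sup>2) \<noteq> 0" if "B \<in> X" for B
      using outer_energy_deriv_pos [OF w, of B] that unfolding X_def by (metis less_irrefl)
    show "continuous_on X (\<lambda>B. ((1 - \<omega>) * (1 + B) - 1) / (2 * (1 + B)\<^sup>2))"
      by (intro continuous_intros) (use pos in force)
    show "continuous_on X (\<lambda>B. 4 * I' B)" by (intro continuous_intros cI)
  qed (auto simp: e f less_imp_le pos)
  then show "period \<omega> C1_differentiable_on {crit_energy \<omega><..}" by (simp add: e)
  have "strict_mono_on X (\<lambda>B. - I B)"
    by (rule DERIV_pos_imp_strict_mono_on [OF X(1) DERIV_minus [OF dI] I'neg])
  then have I_mono: "r < s \<Longrightarrow> I s < I r" if "r \<in> X" "s \<in> X" for r s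
    using that by (auto dest: strict_mono_onD)
  show "strict_antimono_on {crit_energy \<omega><..} (period \<omega>)"
    unfolding e [symmetric]
  proof (rule monotone_onI)
    fix E F assume "E \<in> outer_energy \<omega> ` X" "F \<in> outer_energy \<omega> ` X" "E < F"
    then obtain r s where rs: "r \<in> X" "s \<in> X" "E = outer_energy \<omega> r" "F = outer_energy \<omega> s" by auto
    have "r < s"
      using strict_mono_on_leD [OF e_mono, of s r] rs \<open>E < F\<close> by (cases "r < s") auto
    then show "period \<omega> F < period \<omega> E"
      using rs f I_mono by simp
  qed
qed

section \<open>Assembly of the inner and outer energy ranges\<close>

theorem theorem1p3:
  shows "(\<forall>\<omega>. 0 < \<omega> \<and> \<omega> < 1 \<longrightarrow>
            period \<omega> C1_differentiable_on ({0<..} - {crit_energy \<omega>})) \<and>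
         (\<forall>\<omega><0. period \<omega> C1_differentiable_on {crit_energy \<omega><..}) \<and>
         (\<forall>\<omega>. 0 < \<omega> \<and> \<omega> < 1 \<longrightarrow>
            strict_mono_on {0<..<crit_energy \<omega>} (period \<omega>)) \<and>
         (\<forall>\<omega><1. strict_antimono_on {crit_energy \<omega><..} (period \<omega>))"
proof (intro conjI allI impI)
  fix \<omega> :: real assume w: "0 < \<omega> \<and> \<omega> < 1"
  \<comment> \<open>Positivity makes the punctured half-line the union of the inner and the outer
    energy range. Both are open, so differentiability with continuous derivative passes to the
    union.\<close>
  have "0 < crit_energy \<omega>"
    using w lin_coord_pos [of "\<omega> / (1 - \<omega>)"] by (simp add: crit_energy_lin_coord)
  then have split: "{0<..} - {crit_energy \<omega>} = {0<..<crit_energy \<omega>} \<union> {crit_energy \<omega><..}"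
    by auto
  show "period \<omega> C1_differentiable_on ({0<..} - {crit_energy \<omega>})"
    unfolding split using w
    by (intro C1_differentiable_on_open_Un period_inner_C1_strict_mono(1)
        period_outer_C1_strict_antimono(1) open_greaterThan open_greaterThanLessThan) simp_all
next
  show "period \<omega> C1_differentiable_on {crit_energy \<omega><..}" if "\<omega> < 0" for \<omega>
    using that by (intro period_outer_C1_strict_antimono(1)) simp
next
  show "strict_mono_on {0<..<crit_energy \<omega>} (period \<omega>)" if "0 < \<omega> \<and> \<omega> < 1" for \<omega>
    using that by (intro period_inner_C1_strict_mono(2)) simp_all
next
  show "strict_antimono_on {crit_energy \<omega><..} (period \<omega>)" if "\<omega> < 1" for \<omega>
    using that by (rule period_outer_C1_strict_antimono(2))
qed

end
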